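(* Let $\zeta$ be a primitive aperiodic substitution on $\mathcal{A}=\{1,\ldots,m\}$ with substitution matrix $\mathsf{S}$. Let $\theta$ be the Perron-Frobenius eigenvalue of $\mathsf{S}$, and let $\vec r,\vec\ell$ be, respectively, the (right) eigenvectors of $\mathsf{S}$ and $\mathsf{S}^{\mathsf T}$ corresponding to $\theta$, normalized by the condition $\langle \vec r,\vec \ell\rangle=1$. Then $$ \mathbf{\Sigma}_\zeta=\frac{1}{\langle \vec r,\vec 1\rangle\,\langle \vec 1,\vec \ell\rangle}\cdot \text{weak*-}\lim_{n\to\infty}\theta^{-n}\,\overline{\mathbf{\Pi}_n^*(\omega)\,\mathbf{\Pi}_n(\omega)}\,d\omega , $$ where $\mathbf{\Sigma}_\zeta$ is the matrix of correlation measures of $\zeta$, $\mathbf{\Pi}_n(\omega)$ is the associated matrix Riesz-type product, $\vec 1=[1,\ldots,1]^{\mathsf T}$, and the weak* limit is taken entrywise.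
   Context: A substitution on the finite alphabet $\mathcal{A}=\{1,\ldots,m\}$ is a map $\zeta:\mathcal{A}\to\mathcal{A}^+$ ($\mathcal{A}^+$ = nonempty finite words), extended to words by concatenation. Its substitution matrix $\mathsf{S}=\mathsf{S}_\zeta$ is the $m\times m$ matrix with $\mathsf{S}(i,j)$ = number of symbols $i$ in $\zeta(j)$. $\zeta$ is primitive if some power of $\mathsf{S}$ is entrywise strictly positive; then the Perron-Frobenius (PF) eigenvalue is the dominant eigenvalue $\theta$, with strictly positive eigenvectors. The eigenvectors $\vec r$ and $\vec\ell$ are taken real (strictly positive up to sign). The substitution space $X_\zeta\subset\mathcal{A}^{\mathbb{Z}}$ is the set of bi-infinite sequences all of whose finite subwords occur in $\zeta^n(a)$ for some $a\in\mathcal{A}$, $n\in\mathbb{N}$; $T$ is the left shift on $X_\zeta$. $\zeta$ is aperiodic if $X_\zeta$ contains no periodic sequences. For primitive $\zeta$ the system $(X_\zeta,T)$ has a unique invariant Borel probability measure $\mu$. Let $U f=f\circ T$ on $L^2(X_\zeta,\mu)$. For $f,g\in L^2(X_\zeta,\mu)$ the complex spectral measure $\sigma_{f,g}$ on $\mathbb{R}/\mathbb{Z}\cong[0,1)$ is determined by $\int_0^1 e^{2\pi i k\omega}\,d\sigma_{f,g}(\omega)=\langle U^kf,g\rangle$ for all $k\in\mathbb{Z}$, where $\langle f,g\rangle=\int f\overline{g}\,d\mu$. For $a,b\in\mathcal{A}$ let $[a]=\{x\in X_\zeta: x_0=a\}$ and let $\sigma_{a,b}=\sigma_{\mathbf{1}_{[a]},\mathbf{1}_{[b]}}$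 (correlation measures). $\mathbf{\Sigma}_\zeta$ is the $m\times m$ matrix of measures with entries $\mathbf{\Sigma}_\zeta(a,b)=\sigma_{a,b}$. For a word $v=v_0v_1\cdots v_{|v|-1}$ (of length $|v|$) and $a\in\mathcal{A}$, put $\Phi_a(v,\omega)=\sum_{0\le j<|v|,\ v_j=a}e^{-2\pi i\omega j}$. The matrix $\mathbf{\Pi}_n(\omega)$ is the $m\times m$ matrix whose entry in row $b$ and column $a$ is $\Phi_a(\zeta^n(b),\omega)$. Equivalently, $\mathbf{\Pi}_n(\omega)=\mathbf{M}_{n-1}(\omega)\mathbf{M}_{n-2}(\omega)\cdots\mathbf{M}_0(\omega)$, where, writing $\zeta(b)=u_1^{(b)}\cdots u_{k_b}^{(b)}$, $$(\mathbf{M}_{n}(\omega))(b,c)=\sum_{j\le k_b:\ u_j^{(b)}=c}\exp\left[-2\pi i\omega\left(|\zeta^{n}(u_1^{(b)})|+\cdots+|\zeta^{n}(u_{j-1}^{(b)})|\right)\right].$$ Here $^*$ denotes the conjugate transpose, the overline denotes entrywise complex conjugation, and $\langle\cdot,\cdot\rangle$ applied to vectors is the scalar product in $\mathbb{R}^m$. For an integrable function $h$, $h(\omega)\,d\omega$ denotes the absolutely continuous measure on $\mathbb{R}/\mathbb{Z}$ with density $h$, and weak* convergence is that of measures on $\mathbb{R}/\mathbb{Z}$. *)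

theory Defs
  imports "HOL-Probability.Probability" "HOL-Library.Sublist"
begin

section \<open>Substitutions\<close>

text \<open>The alphabet \<open>{1,\<dots>,m}\<close> is an arbitrary finite type \<open>'a\<close>, with \<open>m = CARD('a)\<close>.\<close>

definition substitution :: "('a \<Rightarrow> 'a list) \<Rightarrow> bool" where
  "substitution \<zeta> \<longleftrightarrow> (\<forall>a. \<zeta> a \<noteq> [])"

definition subst_word :: "('a \<Rightarrow> 'a list) \<Rightarrow> 'a list \<Rightarrow> 'a list" where
  "subst_word \<zeta> w = concat (map \<zeta> w)"

definition subst_iter :: "('a \<Rightarrow> 'a list) \<Rightarrow> nat \<Rightarrow> 'a \<Rightarrow> 'a list" where
  "subst_iter \<zeta> n a = (subst_word \<zeta> ^^ n) [a]"

definition subst_matrix :: "('a::finite \<Rightarrow> 'a list) \<Rightarrow> real^'a^'a" where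
  "subst_matrix \<zeta> = (\<chi> i j. real (count_list (\<zeta> j) i))"

text \<open>The product \<open>**\<close> is used because \<open>^\<close> on type \<open>vec\<close> is the entrywise power.\<close>

definition mat_power :: "real^'a^'a \<Rightarrow> nat \<Rightarrow> real^'a^'a" where
  "mat_power A n = ((\<lambda>B. A ** B) ^^ n) (mat 1)"

definition primitive_subst :: "('a::finite \<Rightarrow> 'a list) \<Rightarrow> bool" where
  "primitive_subst \<zeta> \<longleftrightarrow> (\<exists>k\<ge>1. \<forall>i j. mat_power (subst_matrix \<zeta>) k $ i $ j > 0)"

definition mat_eigenvalue :: "'k::field^'a^'a \<Rightarrow> 'k \<Rightarrow> bool" where
  "mat_eigenvalue A z \<longleftrightarrow> (\<exists>v. v \<noteq> 0 \<and> A *v v = z *s v)"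

definition pf_eigenvalue :: "real^'a^'a \<Rightarrow> real \<Rightarrow> bool" where
  "pf_eigenvalue A \<theta> \<longleftrightarrow>
     mat_eigenvalue A \<theta> \<and>
     (\<forall>z. mat_eigenvalue (map_matrix complex_of_real A) z \<and> z \<noteq> complex_of_real \<theta> \<longrightarrow> cmod z < \<theta>)"


section \<open>The substitution dynamical system\<close>

definition subst_space :: "('a \<Rightarrow> 'a list) \<Rightarrow> (int \<Rightarrow> 'a) set" where
  "subst_space \<zeta> =
     {x. \<forall>i len. \<exists>a n. sublist (map (\<lambda>j. x (i + int j)) [0..<len]) (subst_iter \<zeta> n a)}"

text \<open>\<open>shift k\<close> is the \<open>k\<close>-th power, \<open>k \<in> \<int>\<close>, of the left shift \<open>T = shift 1\<close>.\<close>

definition shift :: "int \<Rightarrow> (int \<Rightarrow> 'a) \<Rightarrow> (int \<Rightarrow> 'a)" where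
  "shift k x = (\<lambda>j. x (j + k))"

definition aperiodic_subst :: "('a \<Rightarrow> 'a list) \<Rightarrow> bool" where
  "aperiodic_subst \<zeta> \<longleftrightarrow> \<not> (\<exists>x \<in> subst_space \<zeta>. \<exists>p>0. shift p x = x)"

text \<open>For a finite alphabet the product \<open>\<sigma>\<close>-algebra of the discrete ones is the Borel
  \<open>\<sigma>\<close>-algebra of the product topology.\<close>

definition invariant_prob :: "('a \<Rightarrow> 'a list) \<Rightarrow> (int \<Rightarrow> 'a) measure \<Rightarrow> bool" where
  "invariant_prob \<zeta> \<mu> \<longleftrightarrow>
     prob_space \<mu> \<and>
     sets \<mu> = sets (restrict_space (PiM UNIV (\<lambda>_. count_space UNIV)) (subst_space \<zeta>)) \<and>
     distr \<mu> \<mu> (shift 1) = \<mu>"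

definition cylinder :: "('a \<Rightarrow> 'a list) \<Rightarrow> 'a \<Rightarrow> (int \<Rightarrow> 'a) set" where
  "cylinder \<zeta> a = {x \<in> subst_space \<zeta>. x 0 = a}"


section \<open>Complex measures\<close>

text \<open>A complex measure on the \<open>\<sigma>\<close>-algebra of \<open>M\<close> is a countably additive set function, extended
  by \<open>0\<close> to non-measurable sets, as is \<^const>\<open>emeasure\<close>. Only \<open>space M\<close> and \<open>sets M\<close> matter.\<close>

definition complex_measure :: "'b measure \<Rightarrow> ('b set \<Rightarrow> complex) \<Rightarrow> bool" where
  "complex_measure M \<nu> \<longleftrightarrow>
     \<nu> {} = 0 \<and>
     (\<forall>A. A \<notin> sets M \<longrightarrow> \<nu> A = 0) \<and>
     (\<forall>A :: nat \<Rightarrow> 'b set. range A \<subseteq> sets M \<and> disjoint_family A \<longrightarrow>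
        (\<lambda>i. \<nu> (A i)) sums \<nu> (\<Union>i. A i))"

text \<open>The positive part \<open>\<nu>\<^sup>+\<close> of a signed measure in its Jordan decomposition,
  \<open>\<nu>\<^sup>+(E) = sup {\<nu>(A) | A \<subseteq> E}\<close>; the negative part is the positive part of \<open>-\<nu>\<close>. The truncation
  of negative numbers by \<^const>\<open>ennreal\<close> is harmless, as \<open>A = {}\<close> contributes \<open>0\<close>.\<close>

definition upper_variation :: "'b measure \<Rightarrow> ('b set \<Rightarrow> real) \<Rightarrow> 'b measure" where
  "upper_variation M \<nu> =
     measure_of (space M) (sets M) (\<lambda>E. SUP A\<in>{A \<in> sets M. A \<subseteq> E}. ennreal (\<nu> A))"

definition signed_integral :: "'b measure \<Rightarrow> ('b set \<Rightarrow> real) \<Rightarrow> ('b \<Rightarrow> complex) \<Rightarrow> complex" where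
  "signed_integral M \<nu> f =
     integral\<^sup>L (upper_variation M \<nu>) f - integral\<^sup>L (upper_variation M (\<lambda>A. - \<nu> A)) f"

definition cm_integral :: "'b measure \<Rightarrow> ('b set \<Rightarrow> complex) \<Rightarrow> ('b \<Rightarrow> complex) \<Rightarrow> complex" where
  "cm_integral M \<nu> f =
     signed_integral M (\<lambda>A. Re (\<nu> A)) f + \<i> * signed_integral M (\<lambda>A. Im (\<nu> A)) f"

definition cm_density :: "'b measure \<Rightarrow> ('b \<Rightarrow> complex) \<Rightarrow> 'b set \<Rightarrow> complex" where
  "cm_density M h A = (if A \<in> sets M then set_lebesgue_integral M A h else 0)"

text \<open>The circle \<open>\<real>/\<int>\<close>, realised as \<open>[0,1)\<close> with its Borel sets and Lebesgue measure. Continuous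
  functions on it are continuous functions on the line of period 1.\<close>

definition circle :: "real measure" where
  "circle = restrict_space lborel {0..<1}"

definition weak_star_limit :: "(nat \<Rightarrow> real set \<Rightarrow> complex) \<Rightarrow> (real set \<Rightarrow> complex) \<Rightarrow> bool" where
  "weak_star_limit \<nu> L \<longleftrightarrow>
     complex_measure circle L \<and>
     (\<forall>f :: real \<Rightarrow> complex. continuous_on UNIV f \<and> (\<forall>\<omega>. f (\<omega> + 1) = f \<omega>) \<longrightarrow>
        (\<lambda>n. cm_integral circle (\<nu> n) f) \<longlonglongrightarrow> cm_integral circle L f)"


section \<open>Spectral measures and the matrix Riesz product\<close>

text \<open>\<open>\<sigma> = \<sigma>\<^bsub>f,g\<^esub>\<close>; note that \<open>U\<^sup>k f = f \<circ> shift k\<close>.\<close>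

definition spectral_measure ::
  "(int \<Rightarrow> 'a) measure \<Rightarrow> ((int \<Rightarrow> 'a) \<Rightarrow> complex) \<Rightarrow> ((int \<Rightarrow> 'a) \<Rightarrow> complex) \<Rightarrow> (real set \<Rightarrow> complex) \<Rightarrow> bool"
where
  "spectral_measure \<mu> f g \<sigma> \<longleftrightarrow>
     complex_measure circle \<sigma> \<and>
     (\<forall>k::int. cm_integral circle \<sigma> (\<lambda>\<omega>. exp (2 * of_real pi * \<i> * of_int k * of_real \<omega>)) =
        (\<integral>x. (f \<circ> shift k) x * cnj (g x) \<partial>\<mu>))"

definition correlation_matrix ::
  "('a \<Rightarrow> 'a list) \<Rightarrow> (int \<Rightarrow> 'a) measure \<Rightarrow> ('a \<Rightarrow> 'a \<Rightarrow> real set \<Rightarrow> complex) \<Rightarrow> bool" where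
  "correlation_matrix \<zeta> \<mu> \<Sigma> \<longleftrightarrow>
     (\<forall>a b. spectral_measure \<mu> (indicator (cylinder \<zeta> a)) (indicator (cylinder \<zeta> b)) (\<Sigma> a b))"

definition Phi :: "'a \<Rightarrow> 'a list \<Rightarrow> real \<Rightarrow> complex" where
  "Phi a v \<omega> = (\<Sum>j\<in>{j. j < length v \<and> v ! j = a}. exp (- 2 * of_real pi * \<i> * of_real \<omega> * of_nat j))"

definition Riesz_matrix :: "('a::finite \<Rightarrow> 'a list) \<Rightarrow> nat \<Rightarrow> real \<Rightarrow> complex^'a^'a" where
  "Riesz_matrix \<zeta> n \<omega> = (\<chi> b a. Phi a (subst_iter \<zeta> n b) \<omega>)"

definition conj_transpose :: "complex^'a^'b \<Rightarrow> complex^'b^'a" where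
  "conj_transpose A = map_matrix cnj (transpose A)"

end

theory Submission
  imports Defs
begin

text \<open>
  Both sides of the identity are determined by their Fourier coefficients, and these count pairs of
  letters. For a word \<open>v\<close>, the \<open>k\<close>-th coefficient of \<open>Phi a v \<cdot> cnj (Phi b v)\<close> is the number of
  positions \<open>j\<close> with \<open>v\<^sub>j = b\<close> and \<open>v\<^bsub>j+k\<^esub> = a\<close>; the \<open>(a, b)\<close> entry of the conjugated matrix
  product is the sum of these functions over the words \<open>v = \<zeta>\<^sup>n(c)\<close>. The \<open>k\<close>-th coefficient of \<open>\<Sigma> a b\<close>
  is \<open>\<mu> {x. x\<^sub>k = a \<and> x\<^sub>0 = b}\<close>. Hence the theorem has two ingredients.

  \<^item> \<^emph>\<open>The frequency of a pair in \<open>\<zeta>\<^sup>n(c)\<close> tends to its \<open>\<mu>\<close>-probability\<close> (\<open>pair_count_limit\<close>). The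
    substitution matrix satisfies \<open>S\<^sup>n / \<theta>\<^sup>n \<longlonglongrightarrow> r l\<^sup>T\<close> (\<open>primitive_powers_asymptotics\<close>), so the length
    of \<open>\<zeta>\<^sup>n(c)\<close> is asymptotic to \<open>\<theta>\<^sup>n \<langle>r, 1\<rangle> l\<^sub>c\<close>. Counting pairs is additive under concatenation up to
    a bounded error; for such functionals the frequency in \<open>\<zeta>\<^sup>n(c)\<close> has a limit \<open>G\<close> that does not
    depend on \<open>c\<close> (\<open>quasi_additive_limit\<close>), and every long word of the language has nearly this
    frequency, since it is almost a concatenation of blocks \<open>\<zeta>\<^sup>p(d)\<close> (\<open>language_discrepancy\<close>).
    Integrating the count over a long window of a \<open>\<mu>\<close>-random point identifies \<open>G\<close> with the
    probability, by invariance of \<open>\<mu>\<close>. Summing \<open>\<langle>r, 1\<rangle> l\<^sub>c G\<close> over \<open>c\<close> produces the constant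
    \<open>\<langle>r, 1\<rangle> \<langle>1, l\<rangle>\<close>.

  \<^item> \<^emph>\<open>Convergence of Fourier coefficients implies weak-star convergence when the densities are bounded
    in \<open>L\<^sup>1\<close>\<close> (\<open>weak_star_limit_by_moments\<close>). Trigonometric polynomials are dense by
    Stone--Weierstrass. The bound comes from \<open>\<bar>u v\<bar> \<le> (\<bar>u\<bar>\<^sup>2 + \<bar>v\<bar>\<^sup>2) / 2\<close> and from the fact that
    \<open>\<bar>Phi a v\<bar>\<^sup>2\<close> has integral equal to the number of letters \<open>a\<close> in \<open>v\<close>.

  The limit is then \<open>L a b = \<langle>r, 1\<rangle> \<langle>1, l\<rangle> \<cdot> \<Sigma> a b\<close>. Since integrals against complex measures are defined
  through the positive variations of real and imaginary parts, it has to be shown that such a variation is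
  a finite measure and that it agrees with \<open>max 0 (Re h)\<close> resp. \<open>max 0 (Im h)\<close> for a density \<open>h\<close>.
\<close>

section \<open>Perron--Frobenius asymptotics of primitive matrices\<close>

lemma mat_power_0 [simp]: "mat_power A 0 = mat 1"
  by (simp add: mat_power_def)

lemma mat_power_Suc: "mat_power A (Suc n) = A ** mat_power A n"
  by (simp add: mat_power_def)

lemma mat_power_add: "mat_power A (m + n) = mat_power A m ** mat_power A n"
  by (induction m) (simp_all add: mat_power_Suc matrix_mul_assoc)

lemma transpose_mat_power: "transpose (mat_power A n) = mat_power (transpose A) n"
proof (induction n)
  case 0
  show ?case by (simp add: transpose_mat)
next
  case (Suc n)
  have "mat_power A (Suc n) = mat_power A n ** A"
    using mat_power_add[of A n 1] by (simp add: mat_power_Suc)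
  then show ?case
    by (simp add: matrix_transpose_mul Suc mat_power_Suc)
qed

lemma mat_power_eigenvector:
  assumes "A *v x = \<rho> *s x"
  shows "mat_power A n *v x = \<rho> ^ n *s x"
proof (induction n)
  case (Suc n)
  have "mat_power A (Suc n) *v x = A *v (mat_power A n *v x)"
    by (simp add: mat_power_Suc matrix_vector_mul_assoc)
  also have "\<dots> = \<rho> ^ n *s (A *v x)"
    by (simp add: Suc vector_scalar_commute)
  finally show ?case
    by (simp add: assms vector_smult_assoc mult.commute)
qed simp

text \<open>Brouwer's theorem on the probability simplex. The map normalises \<open>x + A x\<close> instead of \<open>A x\<close>, so that
  the normalising sum is at least \<open>1\<close> even where \<open>A x\<close> vanishes; a fixed point is an eigenvector of
  \<open>A\<close> all the same. Positivity of the eigenvector and the eigenvalue is read off from \<open>A\<^sup>k\<close>.\<close>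

lemma primitive_positive_eigenvector:
  fixes A :: "real^'n^'n"
  assumes nonneg: "\<And>i j. 0 \<le> A $ i $ j"
    and prim: "1 \<le> k" "\<And>i j. 0 < mat_power A k $ i $ j"
  obtains x \<rho> where "A *v x = \<rho> *s x" "0 < \<rho>" "\<And>i. 0 < x $ i"
proof -
  define S :: "(real^'n) set" where "S = {x. (\<forall>i. 0 \<le> x $ i) \<and> (\<Sum>i\<in>UNIV. x $ i) = 1}"
  define s where "s = (\<lambda>x. \<Sum>i\<in>UNIV. (x + A *v x) $ i)"
  define f where "f = (\<lambda>x. (1 / s x) *\<^sub>R (x + A *v x))"
  have Ax: "0 \<le> (A *v x) $ i" if "x \<in> S" for x i
    using that nonneg by (auto simp: S_def matrix_vector_mult_def intro!: sum_nonneg)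
  have s1: "s x \<ge> 1" if "x \<in> S" for x
  proof -
    have "s x = 1 + (\<Sum>i\<in>UNIV. (A *v x) $ i)"
      using that by (simp add: s_def S_def sum.distrib)
    then show ?thesis using Ax[OF that] by (simp add: sum_nonneg)
  qed
  have bounded: "bounded S"
  proof (rule boundedI)
    fix x assume x: "x \<in> S"
    have "norm x \<le> (\<Sum>i\<in>UNIV. \<bar>x $ i\<bar>)" by (rule norm_le_l1_cart)
    also have "\<dots> = (\<Sum>i\<in>UNIV. x $ i)" using x by (intro sum.cong) (auto simp: S_def)
    finally show "norm x \<le> 1" using x by (simp add: S_def)
  qed
  have "S = (\<Inter>i. {x. 0 \<le> x $ i}) \<inter> {x. (\<Sum>i\<in>UNIV. x $ i) = 1}"
    by (auto simp: S_def)
  also have "closed \<dots>"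
    by (intro closed_Int closed_INT ballI closed_Collect_le closed_Collect_eq continuous_intros)
  finally have "compact S" using bounded by (simp add: compact_eq_bounded_closed)
  moreover have "convex S"
    by (auto simp: convex_def S_def sum.distrib simp flip: sum_distrib_left)
  moreover have "axis undefined 1 \<in> S"
    by (auto simp: S_def axis_def sum.delta)
  moreover have "continuous_on S f"
    unfolding f_def s_def
    by (intro continuous_intros linear_continuous_on_compose matrix_vector_mul_linear)
       (use s1 in \<open>fastforce simp: s_def\<close>)+
  moreover have "f \<in> S \<rightarrow> S"
  proof
    fix x assume x: "x \<in> S"
    have "(\<Sum>i\<in>UNIV. f x $ i) = s x / s x"
      by (simp add: f_def s_def flip: sum_divide_distrib)
    moreover have "0 \<le> f x $ i" for i
      using s1[OF x] Ax[OF x, of i] x by (auto simp: f_def S_def)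
    ultimately show "f x \<in> S" using s1[OF x] by (simp add: S_def)
  qed
  ultimately obtain x where x: "x \<in> S" "f x = x"
    using brouwer[of S f] by blast
  have "x + A *v x = s x *\<^sub>R x"
  proof -
    have "s x *\<^sub>R f x = x + A *v x"
      using s1[OF x(1)] by (simp add: f_def)
    then show ?thesis using x(2) by simp
  qed
  then have eig: "A *v x = (s x - 1) *s x"
    by (simp add: scaleR_diff_left scalar_mult_eq_scaleR algebra_simps)
  have nn: "\<And>i. 0 \<le> x $ i" using x by (simp add: S_def)
  have "\<exists>j. x $ j \<noteq> 0"
  proof (rule ccontr)
    assume "\<not> ?thesis"
    then show False using x(1) by (simp add: S_def)
  qed
  then obtain j where j: "0 < x $ j" using nn by (metis less_eq_real_def)
  have pos: "0 < (s x - 1) ^ k * x $ i" for i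
  proof -
    have "0 < (\<Sum>j\<in>UNIV. mat_power A k $ i $ j * x $ j)"
      using less_imp_le[OF prim(2)] prim(2) nn j by (intro sum_pos2[where i=j]) auto
    also have "\<dots> = (mat_power A k *v x) $ i" by (simp add: matrix_vector_mult_def)
    finally show ?thesis by (simp add: mat_power_eigenvector[OF eig])
  qed
  show thesis
  proof (rule that[OF eig])
    show "0 < s x - 1"
      using pos[of j] s1[OF x(1)] prim(1) by (cases "s x = 1") (auto simp: power_0_left)
    show "0 < x $ i" for i
      using pos[of i] nn[of i] by (cases "x $ i = 0") auto
  qed
qed

text \<open>Let \<open>x\<close> and \<open>y\<close> be positive eigenvectors of \<open>A\<close> and of its transpose. Pairing them shows that they
  have the same eigenvalue \<open>\<rho>\<close>. Pairing \<open>y\<close> with \<open>\<theta> \<bar>v\<bar> \<le> A \<bar>v\<bar>\<close> for an eigenvector \<open>v\<close> of \<open>\<theta>\<close> gives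
  \<open>\<theta> \<le> \<rho>\<close>, and if \<open>\<rho>\<close> were different from \<open>\<theta>\<close>, then dominance of \<open>\<theta>\<close> would give \<open>\<rho> < \<theta>\<close>.\<close>

lemma pf_eigenvalue_positive_eigenvector:
  fixes A :: "real^'n^'n"
  assumes nonneg: "\<And>i j. 0 \<le> A $ i $ j"
    and prim: "1 \<le> k" "\<And>i j. 0 < mat_power A k $ i $ j"
    and pf: "pf_eigenvalue A \<theta>"
  obtains y where "transpose A *v y = \<theta> *s y" "\<And>i. 0 < y $ i" "0 < \<theta>"
proof -
  obtain x \<rho>' where x: "A *v x = \<rho>' *s x" "0 < \<rho>'" "\<And>i. 0 < x $ i"
    using primitive_positive_eigenvector[OF assms(1-3)] by blast
  have nonneg': "0 \<le> transpose A $ i $ j" for i j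
    by (simp add: transpose_def nonneg)
  have prim': "0 < mat_power (transpose A) k $ i $ j" for i j
    unfolding transpose_mat_power[symmetric] using prim(2)[of j i] by (simp add: transpose_def)
  obtain y \<rho> where y: "transpose A *v y = \<rho> *s y" "0 < \<rho>" "\<And>i. 0 < y $ i"
    using primitive_positive_eigenvector[OF nonneg' prim(1) prim'] by blast
  have pair: "y \<bullet> (A *v v) = \<rho> * (y \<bullet> v)" for v
  proof -
    have "y \<bullet> (A *v v) = (transpose A *v y) \<bullet> v"
      by (simp add: dot_lmul_matrix del: vector_transpose_matrix flip: vector_transpose_matrix)
    then show ?thesis unfolding y(1) by (simp add: scalar_mult_eq_scaleR)
  qed
  have "0 < y \<bullet> x"
    using x(3) y(3) by (auto simp: inner_vec_def intro!: sum_pos)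
  moreover have "\<rho>' * (y \<bullet> x) = \<rho> * (y \<bullet> x)"
    using pair[of x] by (simp add: x(1) scalar_mult_eq_scaleR)
  ultimately have x1: "A *v x = \<rho> *s x" using x(1) by simp
  have le: "\<theta> \<le> \<rho>"
  proof -
    obtain v where v: "v \<noteq> 0" "A *v v = \<theta> *s v"
      using pf by (auto simp: pf_eigenvalue_def mat_eigenvalue_def)
    define w where "w = (\<chi> i. \<bar>v $ i\<bar>)"
    have "\<theta> * w $ i \<le> (A *v w) $ i" for i
    proof -
      have "\<theta> * w $ i \<le> \<bar>(A *v v) $ i\<bar>"
        by (auto simp: v(2) w_def abs_mult intro: mult_right_mono)
      also have "\<dots> \<le> (\<Sum>j\<in>UNIV. \<bar>A $ i $ j * v $ j\<bar>)"
        by (simp add: matrix_vector_mult_def sum_abs)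
      also have "\<dots> = (A *v w) $ i"
        using nonneg by (simp add: matrix_vector_mult_def w_def abs_mult)
      finally show ?thesis .
    qed
    then have "y \<bullet> (\<theta> *s w) \<le> y \<bullet> (A *v w)"
      using less_imp_le[OF y(3)] by (auto simp: inner_vec_def intro!: sum_mono mult_left_mono)
    then have "\<theta> * (y \<bullet> w) \<le> \<rho> * (y \<bullet> w)" by (simp add: pair scalar_mult_eq_scaleR)
    moreover have "0 < y \<bullet> w"
    proof -
      obtain i where "v $ i \<noteq> 0" using v(1) by (auto simp: vec_eq_iff)
      then show ?thesis
        using y(3) unfolding inner_vec_def
        by (intro sum_pos2[where i=i]) (auto simp: w_def less_imp_le)
    qed
    ultimately show ?thesis by simp
  qed
  have "\<rho> = \<theta>"
  proof (rule ccontr)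
    assume ne: "\<rho> \<noteq> \<theta>"
    define z where "z = (\<chi> i. complex_of_real (x $ i))"
    have "mat_eigenvalue (map_matrix complex_of_real A) (complex_of_real \<rho>)"
      unfolding mat_eigenvalue_def
    proof (intro exI conjI)
      have "z $ undefined \<noteq> 0" using x(3)[of undefined] by (simp add: z_def)
      then show "z \<noteq> 0" by auto
      have "(map_matrix complex_of_real A *v z) $ i = complex_of_real ((A *v x) $ i)" for i
        by (simp add: matrix_vector_mult_def map_matrix_def z_def)
      then show "map_matrix complex_of_real A *v z = complex_of_real \<rho> *s z"
        by (simp add: vec_eq_iff x1 z_def)
    qed
    then have "cmod (complex_of_real \<rho>) < \<theta>"
      using pf ne by (auto simp: pf_eigenvalue_def)
    then show False using le by simp
  qed
  then show thesis using that y by simp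
qed

text \<open>Doeblin's contraction argument for the powers \<open>P n\<close> of a row-stochastic matrix. Passing from \<open>P n\<close> to
  \<open>P (l + n)\<close> averages the entries of a column, so its maximum \<open>M\<close> decreases and its minimum \<open>m\<close>
  increases; if \<open>P k \<ge> \<delta> > 0\<close>, then \<open>k\<close> steps lower the maximum by at least \<open>\<delta> (M - m)\<close>. As \<open>M\<close>
  converges, \<open>M - m\<close> tends to \<open>0\<close>.\<close>

lemma stochastic_powers_converge:
  fixes P :: "nat \<Rightarrow> 'n::finite \<Rightarrow> 'n \<Rightarrow> real"
  assumes nonneg: "\<And>n j i. 0 \<le> P n j i"
    and stoch: "\<And>n j. (\<Sum>i\<in>UNIV. P n j i) = 1"
    and semigroup: "\<And>m n j i. P (m + n) j i = (\<Sum>d\<in>UNIV. P m j d * P n d i)"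
    and pos: "\<And>j i. 0 < P k j i"
  shows "\<exists>c. \<forall>j. (\<lambda>n. P n j i) \<longlonglongrightarrow> c"
proof -
  define M where "M = (\<lambda>n. Max (range (\<lambda>j. P n j i)))"
  define m where "m = (\<lambda>n. Min (range (\<lambda>j. P n j i)))"
  have M: "P n j i \<le> M n" and m: "m n \<le> P n j i" for n j
    by (auto simp: M_def m_def)
  have "M n \<in> range (\<lambda>j. P n j i)" "m n \<in> range (\<lambda>j. P n j i)" for n
    unfolding M_def m_def by (rule Max_in Min_in; simp)+
  then have Mex: "\<exists>j. M n = P n j i" and mex: "\<exists>j. m n = P n j i" for n
    by (simp_all add: image_iff)
  define \<delta> where "\<delta> = Min (range (\<lambda>(j, d). P k j d))"
  have "\<delta> \<in> range (\<lambda>(j, d). P k j d)" unfolding \<delta>_def by (rule Min_in) auto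
  then have \<delta>0: "0 < \<delta>" using pos by auto
  have \<delta>: "\<delta> \<le> P k j d" for j d
    unfolding \<delta>_def by (rule Min_le) (auto intro: image_eqI[where x="(j,d)"])
  have avg: "P (l + n) j i - m n = (\<Sum>d\<in>UNIV. P l j d * (P n d i - m n))"
            "M n - P (l + n) j i = (\<Sum>d\<in>UNIV. P l j d * (M n - P n d i))" for l n j
    using stoch[of l j] by (simp_all add: semigroup right_diff_distrib sum_subtractf flip: sum_distrib_right)
  have up: "m n \<le> m (l + n)" for l n
  proof -
    obtain j where "m (l + n) = P (l + n) j i" using mex by blast
    moreover have "0 \<le> P (l + n) j i - m n"
      unfolding avg using nonneg m by (auto intro!: sum_nonneg)
    ultimately show ?thesis by simp
  qed
  have down: "M (l + n) \<le> M n" for l n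
  proof -
    obtain j where "M (l + n) = P (l + n) j i" using Mex by blast
    moreover have "0 \<le> M n - P (l + n) j i"
      unfolding avg using nonneg M by (auto intro!: sum_nonneg)
    ultimately show ?thesis by simp
  qed
  have contract: "M (k + n) \<le> M n - \<delta> * (M n - m n)" for n
  proof -
    obtain j where j: "M (k + n) = P (k + n) j i" using Mex by blast
    obtain d where d: "m n = P n d i" using mex by blast
    have "\<delta> * (M n - m n) \<le> P k j d * (M n - P n d i)"
      using \<delta> M[of n d] by (auto simp: d intro: mult_right_mono)
    also have "\<dots> \<le> (\<Sum>d\<in>UNIV. P k j d * (M n - P n d i))"
      by (rule member_le_sum) (use nonneg M in auto)
    finally show ?thesis using avg(2)[of n k j] j by simp
  qed
  have "decseq M" unfolding decseq_Suc_iff using down[of 1] by simp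
  moreover have "0 \<le> M n" for n using M[of n undefined] nonneg[of n undefined i] by simp
  ultimately obtain c where c: "M \<longlonglongrightarrow> c" using decseq_convergent[of M 0] by blast
  have "(\<lambda>n. M n - M (n + k)) \<longlonglongrightarrow> c - c"
    by (intro tendsto_diff c LIMSEQ_ignore_initial_segment)
  then have "(\<lambda>n. (M n - M (n + k)) / \<delta>) \<longlonglongrightarrow> 0 / \<delta>"
    by (intro tendsto_divide) (use \<delta>0 in auto)
  then have lim0: "(\<lambda>n. (M n - M (n + k)) / \<delta>) \<longlonglongrightarrow> 0" by simp
  have osc: "(\<lambda>n. M n - m n) \<longlonglongrightarrow> 0"
  proof (rule tendsto_sandwich[OF _ _ tendsto_const lim0])
    have "M n - m n \<le> (M n - M (n + k)) / \<delta>" for n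
      using contract[of n] \<delta>0 by (simp add: pos_le_divide_eq add.commute[of n] mult.commute)
    then show "\<forall>\<^sub>F n in sequentially. M n - m n \<le> (M n - M (n + k)) / \<delta>" by simp
    have "m n \<le> M n" for n by (rule order_trans[OF m[of n undefined] M])
    then show "\<forall>\<^sub>F n in sequentially. 0 \<le> M n - m n" by simp
  qed
  have mc: "m \<longlonglongrightarrow> c" using tendsto_diff[OF c osc] by simp
  have "(\<lambda>n. P n j i) \<longlonglongrightarrow> c" for j
    by (rule tendsto_sandwich[OF _ _ mc c]) (use M m in auto)
  then show ?thesis by blast
qed

text \<open>With a positive left eigenvector \<open>y\<close>, the matrices \<open>A\<^sup>n(i,j) y\<^sub>i / (\<theta>\<^sup>n y\<^sub>j)\<close> are the powers of a
  stochastic matrix, hence \<open>A\<^sup>n(i,j) / \<theta>\<^sup>n\<close> tends to a rank-one matrix \<open>q\<^sub>i y\<^sub>j\<close>. Applying this limit to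
  \<open>r\<close> and \<open>l\<close> shows that \<open>r\<close> is a multiple of \<open>q\<close> and \<open>l\<close> a multiple of \<open>y\<close>, and \<open>r \<bullet> l = 1\<close> forces
  \<open>r\<^sub>i l\<^sub>j = q\<^sub>i y\<^sub>j\<close>. The signs of \<open>r\<close> and \<open>l\<close> are not determined individually; only such products are.\<close>

theorem primitive_powers_asymptotics:
  fixes A :: "real^'n^'n"
  assumes nonneg: "\<And>i j. 0 \<le> A $ i $ j"
    and prim: "1 \<le> k" "\<And>i j. 0 < mat_power A k $ i $ j"
    and pf: "pf_eigenvalue A \<theta>"
    and r: "A *v r = \<theta> *s r" and l: "transpose A *v l = \<theta> *s l" and rl: "r \<bullet> l = 1"
  shows "0 < \<theta>"
    and "(\<lambda>n. mat_power A n $ i $ j / \<theta> ^ n) \<longlonglongrightarrow> r $ i * l $ j"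
    and "0 < (r \<bullet> 1) * l $ j"
proof -
  obtain y where y: "transpose A *v y = \<theta> *s y" and ypos: "\<And>i. 0 < y $ i" and \<theta>0: "0 < \<theta>"
    using pf_eigenvalue_positive_eigenvector[OF nonneg prim pf] by blast
  note y0 = ypos[THEN less_imp_neq, symmetric]
  show "0 < \<theta>" by fact
  have pow_nonneg: "0 \<le> mat_power A n $ i $ j" for n i j
    by (induction n arbitrary: i j)
       (auto simp: mat_def mat_power_Suc matrix_matrix_mult_def intro!: sum_nonneg mult_nonneg_nonneg nonneg)
  have left: "(\<Sum>i\<in>UNIV. v $ i * mat_power A n $ i $ j) = \<theta> ^ n * v $ j"
    if "transpose A *v v = \<theta> *s v" for v n j
    using arg_cong[OF mat_power_eigenvector[OF that, of n], of "\<lambda>v. v $ j"]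
    unfolding transpose_mat_power[symmetric]
    by (simp add: matrix_vector_mult_def transpose_def mult.commute)
  define P where "P = (\<lambda>n j i. mat_power A n $ i $ j * y $ i / (\<theta> ^ n * y $ j))"
  have "\<exists>c. \<forall>j. (\<lambda>n. P n j i) \<longlonglongrightarrow> c" for i
  proof (rule stochastic_powers_converge)
    show "0 \<le> P n j i" for n j i
      using ypos \<theta>0 pow_nonneg by (auto simp: P_def less_imp_le)
    show "0 < P k j i" for j i
      using ypos \<theta>0 prim(2) by (auto simp: P_def)
    show "(\<Sum>i\<in>UNIV. P n j i) = 1" for n j
      using left[OF y, of n j] \<theta>0 y0[of j]
      by (simp add: P_def mult.commute flip: sum_divide_distrib)
    show "P (m + n) j i = (\<Sum>d\<in>UNIV. P m j d * P n d i)" for m n j i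
    proof -
      have "P (m + n) j i = (\<Sum>d\<in>UNIV. mat_power A n $ i $ d * mat_power A m $ d $ j) * y $ i / (\<theta> ^ (n + m) * y $ j)"
        by (simp add: P_def add.commute[of m] mat_power_add matrix_matrix_mult_def)
      also have "\<dots> = (\<Sum>d\<in>UNIV. P m j d * P n d i)"
        unfolding sum_distrib_right sum_divide_distrib
        by (intro sum.cong refl) (use y0 in \<open>simp add: P_def power_add mult_ac\<close>)
      finally show ?thesis .
    qed
  qed
  then obtain p where p: "\<And>i j. (\<lambda>n. P n j i) \<longlonglongrightarrow> p i" by metis
  define q where "q = (\<lambda>i. p i / y $ i)"
  have q: "(\<lambda>n. mat_power A n $ i $ j / \<theta> ^ n) \<longlonglongrightarrow> q i * y $ j" for i j
  proof -
    have "(\<lambda>n. P n j i * (y $ j / y $ i)) \<longlonglongrightarrow> p i * (y $ j / y $ i)"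
      by (intro tendsto_intros p)
    moreover have "P n j i * (y $ j / y $ i) = mat_power A n $ i $ j / \<theta> ^ n" for n
      using y0 by (simp add: P_def)
    ultimately show ?thesis by (simp add: q_def)
  qed
  have r': "r $ i = q i * (y \<bullet> r)" for i
  proof -
    have "(\<lambda>n. \<Sum>j\<in>UNIV. mat_power A n $ i $ j / \<theta> ^ n * r $ j) \<longlonglongrightarrow> (\<Sum>j\<in>UNIV. q i * y $ j * r $ j)"
      by (intro tendsto_intros q)
    moreover have "(\<Sum>j\<in>UNIV. mat_power A n $ i $ j / \<theta> ^ n * r $ j) = r $ i" for n
      using arg_cong[OF mat_power_eigenvector[OF r, of n], of "\<lambda>v. v $ i"] \<theta>0
      by (simp add: matrix_vector_mult_def flip: sum_divide_distrib)
    ultimately have "r $ i = (\<Sum>j\<in>UNIV. q i * y $ j * r $ j)"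
      by (simp add: LIMSEQ_const_iff)
    then show ?thesis by (simp add: inner_vec_def sum_distrib_left mult.assoc)
  qed
  have left_lim: "v $ j = (\<Sum>i\<in>UNIV. v $ i * q i) * y $ j" if v: "transpose A *v v = \<theta> *s v" for v j
  proof -
    have "(\<lambda>n. \<Sum>i\<in>UNIV. v $ i * (mat_power A n $ i $ j / \<theta> ^ n)) \<longlonglongrightarrow> (\<Sum>i\<in>UNIV. v $ i * (q i * y $ j))"
      by (intro tendsto_intros q)
    moreover have "(\<Sum>i\<in>UNIV. v $ i * (mat_power A n $ i $ j / \<theta> ^ n)) = v $ j" for n
      using left[OF v, of n j] \<theta>0 by (simp flip: sum_divide_distrib)
    ultimately have "v $ j = (\<Sum>i\<in>UNIV. v $ i * (q i * y $ j))"
      by (simp add: LIMSEQ_const_iff)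
    then show ?thesis by (simp add: sum_distrib_right mult.assoc)
  qed
  define t where "t = (\<Sum>i\<in>UNIV. l $ i * q i)"
  have l': "l $ j = t * y $ j" for j unfolding t_def by (rule left_lim[OF l])
  have "r \<bullet> l = (y \<bullet> r) * t"
    by (simp add: inner_vec_def l' sum_distrib_right sum_distrib_left mult_ac)
  then have yt: "(y \<bullet> r) * t = 1" using rl by simp
  then have rl_q: "r $ i * l $ j = q i * y $ j" for i j
  proof -
    have "r $ i * l $ j = q i * y $ j * ((y \<bullet> r) * t)"
      unfolding r'[of i] l'[of j] by (simp only: mult_ac)
    then show ?thesis by (simp add: yt)
  qed
  show "(\<lambda>n. mat_power A n $ i $ j / \<theta> ^ n) \<longlonglongrightarrow> r $ i * l $ j"
    unfolding rl_q by (rule q)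
  have q0: "0 \<le> q i * y $ j" for i j
    by (rule LIMSEQ_le_const[OF q]) (use pow_nonneg \<theta>0 in auto)
  have qnn: "0 \<le> q i" for i using q0[of i i] ypos[of i] by (simp add: zero_le_mult_iff)
  have "(\<Sum>i\<in>UNIV. y $ i * q i) = 1"
    using left_lim[OF y, of undefined] y0[of undefined] by (metis mult_cancel_right1)
  then have "\<exists>i. q i \<noteq> 0" by (rule contrapos_pp) simp
  then obtain i0 where "0 < q i0" using qnn by (metis order_le_less)
  then have "0 < (\<Sum>i\<in>UNIV. q i)"
    by (intro sum_pos2[of _ i0]) (use qnn in auto)
  moreover have "(r \<bullet> 1) * l $ j = (\<Sum>i\<in>UNIV. q i) * y $ j"
    by (simp add: inner_vec_def sum_distrib_right rl_q)
  ultimately show "0 < (r \<bullet> 1) * l $ j" using ypos by simp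
qed

section \<open>Frequencies of quasi-additive functionals\<close>

lemma subst_iter_0 [simp]: "subst_iter \<zeta> 0 a = [a]"
  by (simp add: subst_iter_def)

lemma subst_iter_Suc: "subst_iter \<zeta> (Suc n) a = subst_word \<zeta> (subst_iter \<zeta> n a)"
  by (simp add: subst_iter_def)

lemma funpow_subst_word: "(subst_word \<zeta> ^^ n) w = concat (map (subst_iter \<zeta> n) w)"
proof (induction n)
  case (Suc n)
  have "subst_word \<zeta> (concat (map g w)) = concat (map (\<lambda>a. subst_word \<zeta> (g a)) w)" for g
    by (induction w) (simp_all add: subst_word_def)
  then show ?case by (simp add: Suc subst_iter_Suc)
qed (induction w; simp)

lemma subst_iter_add:
  "subst_iter \<zeta> (n + p) a = concat (map (subst_iter \<zeta> p) (subst_iter \<zeta> n a))"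
  by (simp add: funpow_subst_word[symmetric] subst_iter_def add.commute[of n] funpow_add)

lemma sum_list_map_eq_sum_count_list:
  fixes f :: "'a::finite \<Rightarrow> real"
  shows "(\<Sum>x\<leftarrow>w. f x) = (\<Sum>d\<in>UNIV. real (count_list w d) * f d)"
proof (induction w)
  case (Cons x w)
  have "(\<Sum>d\<in>UNIV. real (count_list (x # w) d) * f d)
      = (\<Sum>d\<in>UNIV. (if d = x then f d else 0) + real (count_list w d) * f d)"
    by (intro sum.cong) (auto simp: algebra_simps)
  then show ?case by (simp add: Cons sum.distrib)
qed simp

lemma count_list_concat_map:
  fixes g :: "'a::finite \<Rightarrow> 'b list"
  shows "real (count_list (concat (map g w)) i) = (\<Sum>d\<in>UNIV. real (count_list w d) * real (count_list (g d) i))"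
  unfolding sum_list_map_eq_sum_count_list[symmetric] by (induction w) auto

lemma length_eq_sum_count_list:
  fixes w :: "'a::finite list"
  shows "real (length w) = (\<Sum>d\<in>UNIV. real (count_list w d))"
  using sum_list_map_eq_sum_count_list[of "\<lambda>_. 1" w] by (simp add: sum_list_triv)

lemma mat_power_subst_matrix:
  "mat_power (subst_matrix \<zeta>) n $ i $ j = real (count_list (subst_iter \<zeta> n j) i)"
proof (induction n arbitrary: i j)
  case (Suc n)
  have "real (count_list (subst_iter \<zeta> (Suc n) j) i)
      = (\<Sum>d\<in>UNIV. real (count_list (subst_iter \<zeta> n j) d) * real (count_list (\<zeta> d) i))"
    by (simp add: subst_iter_Suc subst_word_def count_list_concat_map)
  moreover have "subst_matrix \<zeta> $ i $ d = real (count_list (\<zeta> d) i)" for d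
    by (simp add: subst_matrix_def)
  ultimately show ?case
    by (simp add: mat_power_Suc matrix_matrix_mult_def Suc mult.commute)
qed (auto simp: mat_def)

text \<open>The counts below are not additive because an occurrence may straddle the junction of two words.\<close>

definition quasi_additive :: "real \<Rightarrow> ('a list \<Rightarrow> real) \<Rightarrow> bool" where
  "quasi_additive K F \<longleftrightarrow> F [] = 0 \<and> (\<forall>u v. \<bar>F (u @ v) - F u - F v\<bar> \<le> K)"

lemma quasi_additive_const_nonneg: "quasi_additive K F \<Longrightarrow> 0 \<le> K"
  unfolding quasi_additive_def by (metis abs_ge_zero order_trans)

lemma quasi_additive_append: "quasi_additive K F \<Longrightarrow> \<bar>F (u @ v) - F u - F v\<bar> \<le> K"
  by (simp add: quasi_additive_def)

lemma quasi_additive_concat: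
  assumes "quasi_additive K F"
  shows "\<bar>F (concat ws) - (\<Sum>w\<leftarrow>ws. F w)\<bar> \<le> K * real (length ws)"
proof (induction ws)
  case Nil
  show ?case using assms by (simp add: quasi_additive_def)
next
  case (Cons w ws)
  then show ?case
    using quasi_additive_append[OF assms, of w "concat ws"] by (simp add: algebra_simps abs_le_iff)
qed

lemma quasi_additive_linear_bound:
  fixes F :: "'a::finite list \<Rightarrow> real"
  assumes "quasi_additive K F"
  obtains C where "0 \<le> C" "\<And>w. \<bar>F w\<bar> \<le> C * real (length w)"
proof -
  define B where "B = Max (range (\<lambda>a. \<bar>F [a]\<bar>))"
  have B: "\<bar>F [a]\<bar> \<le> B" for a by (simp add: B_def)
  show thesis
  proof (rule that)
    show "0 \<le> B + K"
      using B[of undefined] quasi_additive_const_nonneg[OF assms] by linarith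
    show "\<bar>F w\<bar> \<le> (B + K) * real (length w)" for w
    proof (induction w)
      case Nil
      show ?case using assms by (simp add: quasi_additive_def)
    next
      case (Cons a w)
      then show ?case
        using quasi_additive_append[OF assms, of "[a]" w] B[of a]
        by (simp add: algebra_simps)
    qed
  qed
qed

text \<open>If the value on each block \<open>g c\<close> is so small that it also pays for one junction error \<open>K\<close>, then
  concatenating blocks never accumulates more than \<open>\<epsilon>\<close> per letter; only the incomplete last block
  costs an additional constant.\<close>

lemma quasi_additive_prefix_of_blocks:
  assumes D: "quasi_additive K D"
    and \<epsilon>: "0 \<le> \<epsilon>"
    and block: "\<And>c. \<bar>D (g c)\<bar> + K \<le> \<epsilon> * real (length (g c))"
    and part: "\<And>c u. sublist u (g c) \<Longrightarrow> \<bar>D u\<bar> \<le> M"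
    and w: "prefix w (concat (map g v))"
  shows "\<bar>D w\<bar> \<le> \<epsilon> * real (length w) + M"
  using w
proof (induction v arbitrary: w)
  case Nil
  then show ?case using D part[of "[]" undefined] by (simp add: quasi_additive_def)
next
  case (Cons c v)
  then consider "prefix w (g c)" | u where "w = g c @ u" "prefix u (concat (map g v))"
    by (auto simp: prefix_append)
  then show ?case
  proof cases
    case 1
    then have "\<bar>D w\<bar> \<le> M" by (intro part[of _ c] prefix_imp_sublist)
    moreover have "0 \<le> \<epsilon> * real (length w)" using \<epsilon> by simp
    ultimately show ?thesis by linarith
  next
    case 2
    have "\<bar>D u\<bar> \<le> \<epsilon> * real (length u) + M" using Cons.IH 2 by blast
    then show ?thesis
      using quasi_additive_append[OF D, of "g c" u] block[of c] by (simp add: 2 algebra_simps)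
  qed
qed

text \<open>A subword of a concatenation of blocks lies inside one block, or is a suffix of a block followed by a
  prefix of the remaining concatenation.\<close>

lemma quasi_additive_sublist_of_blocks:
  assumes D: "quasi_additive K D"
    and \<epsilon>: "0 \<le> \<epsilon>"
    and block: "\<And>c. \<bar>D (g c)\<bar> + K \<le> \<epsilon> * real (length (g c))"
    and part: "\<And>c u. sublist u (g c) \<Longrightarrow> \<bar>D u\<bar> \<le> M"
    and w: "sublist w (concat (map g v))"
  shows "\<bar>D w\<bar> \<le> \<epsilon> * real (length w) + (2 * M + K)"
  using w
proof (induction v arbitrary: w)
  case Nil
  then show ?case
    using D part[of "[]" undefined] quasi_additive_const_nonneg[OF D]
    by (simp add: quasi_additive_def)
next
  case (Cons c v)
  have K: "0 \<le> K" by (rule quasi_additive_const_nonneg[OF D])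
  have M: "0 \<le> M" using part[of "[]" undefined] D by (simp add: quasi_additive_def)
  consider "sublist w (g c)" | "sublist w (concat (map g v))"
    | s t where "w = s @ t" "suffix s (g c)" "prefix t (concat (map g v))"
    using Cons.prems by (auto simp: sublist_append)
  then show ?case
  proof cases
    case 1
    have "0 \<le> \<epsilon> * real (length w)" using \<epsilon> by simp
    then show ?thesis using part[OF 1] K M by linarith
  next
    case 2
    then show ?thesis by (rule Cons.IH)
  next
    case 3
    have "\<bar>D s\<bar> \<le> M" by (rule part[of _ c]) (use 3 in \<open>simp add: suffix_imp_sublist\<close>)
    moreover have "\<bar>D t\<bar> \<le> \<epsilon> * real (length t) + M"
      by (rule quasi_additive_prefix_of_blocks
                 [where K = K and D = D and \<epsilon> = \<epsilon> and M = M and g = g and v = v])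
         (rule D | rule \<epsilon> | rule block | rule 3(3) | erule part)+
    moreover have "0 \<le> \<epsilon> * real (length s)" using \<epsilon> by simp
    ultimately show ?thesis
      using quasi_additive_append[OF D, of s t] by (simp add: 3(1) algebra_simps)
  qed
qed

lemma length_limit_from_count_limits:
  fixes w :: "nat \<Rightarrow> 'a::finite list" and r :: "real^'a"
  assumes "\<And>i. (\<lambda>n. real (count_list (w n) i) / s n) \<longlonglongrightarrow> r $ i * c"
  shows "(\<lambda>n. real (length (w n)) / s n) \<longlonglongrightarrow> (r \<bullet> 1) * c"
proof -
  have "(\<lambda>n. \<Sum>i\<in>UNIV. real (count_list (w n) i) / s n) \<longlonglongrightarrow> (\<Sum>i\<in>UNIV. r $ i * c)"
    by (intro tendsto_sum assms)
  then show ?thesis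
    by (simp add: length_eq_sum_count_list sum_divide_distrib inner_vec_def sum_distrib_right)
qed

lemma convergent_finite_family_bounded:
  fixes f :: "nat \<Rightarrow> 'a::finite \<Rightarrow> real"
  assumes "\<And>j. (\<lambda>n. f n j) \<longlonglongrightarrow> L j"
  obtains B where "0 < B" "\<And>n j. f n j \<le> B"
proof -
  have "\<exists>B. \<forall>n. \<bar>f n j\<bar> \<le> B" for j
    using convergent_imp_Bseq[OF convergentI[OF assms[of j]]] by (auto simp: Bseq_def)
  then obtain B where B: "\<And>j n. \<bar>f n j\<bar> \<le> B j" by metis
  have B0: "0 \<le> B j" for j using order_trans[OF abs_ge_zero B[of 0 j]] .
  show thesis
  proof (rule that)
    show "0 < (\<Sum>j\<in>UNIV. B j) + 1" using B0 by (simp add: add_nonneg_pos sum_nonneg)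
    show "f n j \<le> (\<Sum>j\<in>UNIV. B j) + 1" for n j
    proof -
      have "B j \<le> (\<Sum>j\<in>UNIV. B j)" by (rule member_le_sum) (use B0 in auto)
      then show ?thesis using B[of n j] by linarith
    qed
  qed
qed

text \<open>What the frequency argument takes from the spectral theory of the substitution matrix. The column sums of
  the limit matrix \<open>r l\<^sup>T\<close> are positive and \<open>\<theta> > 1\<close>, so the words \<open>\<zeta>\<^sup>n(j)\<close> grow like \<open>\<theta>\<^sup>n\<close>.\<close>

locale expanding_substitution =
  fixes \<zeta> :: "'a::finite \<Rightarrow> 'a list" and \<theta> :: real and r l :: "real^'a"
  assumes substitution: "substitution \<zeta>"
    and \<theta>_gt_1: "1 < \<theta>"
    and count_limit: "\<And>i j. (\<lambda>n. real (count_list (subst_iter \<zeta> n j) i) / \<theta> ^ n) \<longlonglongrightarrow> r $ i * l $ j"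
    and limit_pos: "\<And>j. 0 < (r \<bullet> 1) * l $ j"
begin

lemma length_limit: "(\<lambda>n. real (length (subst_iter \<zeta> n j)) / \<theta> ^ n) \<longlonglongrightarrow> (r \<bullet> 1) * l $ j"
  by (rule length_limit_from_count_limits[OF count_limit])

lemma length_bounded: obtains B where "0 < B" "\<And>n j. real (length (subst_iter \<zeta> n j)) \<le> B * \<theta> ^ n"
proof -
  obtain B where "0 < B" "\<And>n j. real (length (subst_iter \<zeta> n j)) / \<theta> ^ n \<le> B"
    by (rule convergent_finite_family_bounded
               [where f = "\<lambda>n j. real (length (subst_iter \<zeta> n j)) / \<theta> ^ n" and L = "\<lambda>j. (r \<bullet> 1) * l $ j"])
       (use length_limit in auto)
  then show thesis using \<theta>_gt_1 by (intro that[of B]) (simp_all add: pos_divide_le_eq)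
qed

text \<open>Let \<open>u n c = F (\<zeta>\<^sup>n(c)) / \<theta>\<^sup>n\<close>. Cutting \<open>\<zeta>\<^bsup>n+p\<^esup>(c)\<close> into the blocks \<open>\<zeta>\<^sup>p(d)\<close>, one for each letter \<open>d\<close> of
  \<open>\<zeta>\<^sup>n(c)\<close>, gives \<open>u (n + p) c\<close> as a combination of the numbers \<open>u p d\<close> with coefficients
  \<open>S\<^sup>n(d,c) / \<theta>\<^sup>n\<close>, up to an error of order \<open>\<theta>\<^bsup>-p\<^esup>\<close> uniformly in \<open>n\<close>. As \<open>n\<close> grows this combination
  tends to \<open>l\<^sub>c\<close> times \<open>R p = \<Sum> r\<^sub>d \<cdot> u p d\<close>. Hence \<open>u n c\<close> is Cauchy, and letting \<open>p\<close> grow as well, its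
  limit is proportional to \<open>l\<^sub>c\<close>.\<close>

lemma quasi_additive_limit:
  assumes F: "quasi_additive K F"
  obtains R where "\<And>c. (\<lambda>n. F (subst_iter \<zeta> n c) / \<theta> ^ n) \<longlonglongrightarrow> R * l $ c"
proof -
  have \<theta>0: "0 < \<theta> ^ n" for n using \<theta>_gt_1 by simp
  obtain B where B: "0 < B" "\<And>n j. real (length (subst_iter \<zeta> n j)) \<le> B * \<theta> ^ n"
    using length_bounded by blast
  define u where "u = (\<lambda>n c. F (subst_iter \<zeta> n c) / \<theta> ^ n)"
  define v where "v = (\<lambda>p n c. \<Sum>d\<in>UNIV. real (count_list (subst_iter \<zeta> n c) d) / \<theta> ^ n * u p d)"
  define R where "R = (\<lambda>p. \<Sum>d\<in>UNIV. r $ d * u p d)"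
  have near: "\<bar>u (n + p) c - v p n c\<bar> \<le> K * B / \<theta> ^ p" for n p c
  proof -
    let ?w = "subst_iter \<zeta> n c"
    let ?S = "\<Sum>d\<in>UNIV. real (count_list ?w d) * F (subst_iter \<zeta> p d)"
    have "\<bar>F (subst_iter \<zeta> (n + p) c) - ?S\<bar> \<le> K * real (length ?w)"
      using quasi_additive_concat[OF F, of "map (subst_iter \<zeta> p) ?w"]
      by (simp add: subst_iter_add sum_list_map_eq_sum_count_list[symmetric] o_def)
    also have "\<dots> \<le> K * (B * \<theta> ^ n)"
      using B quasi_additive_const_nonneg[OF F] by (intro mult_left_mono)
    finally have "\<bar>F (subst_iter \<zeta> (n + p) c) - ?S\<bar> / \<theta> ^ (n + p)
        \<le> K * (B * \<theta> ^ n) / \<theta> ^ (n + p)"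
      by (rule divide_right_mono) (rule less_imp_le[OF \<theta>0])
    also have "K * (B * \<theta> ^ n) / \<theta> ^ (n + p) = K * B / \<theta> ^ p"
      using \<theta>_gt_1 by (simp add: power_add)
    also have "\<bar>F (subst_iter \<zeta> (n + p) c) - ?S\<bar> / \<theta> ^ (n + p)
        = \<bar>(F (subst_iter \<zeta> (n + p) c) - ?S) / \<theta> ^ (n + p)\<bar>"
      using \<theta>0[of "n + p"] by (simp add: abs_divide)
    also have "(F (subst_iter \<zeta> (n + p) c) - ?S) / \<theta> ^ (n + p)
        = u (n + p) c - v p n c"
      by (simp add: u_def v_def diff_divide_distrib sum_divide_distrib power_add)
    finally show ?thesis .
  qed
  have v: "(\<lambda>n. v p n c) \<longlonglongrightarrow> R p * l $ c" for p c
  proof -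
    have "(\<lambda>n. v p n c) \<longlonglongrightarrow> (\<Sum>d\<in>UNIV. r $ d * l $ c * u p d)"
      unfolding v_def by (intro tendsto_sum tendsto_mult count_limit tendsto_const)
    moreover have "(\<Sum>d\<in>UNIV. r $ d * l $ c * u p d) = R p * l $ c"
      unfolding R_def sum_distrib_right by (rule sum.cong) simp_all
    ultimately show ?thesis by simp
  qed
  have small: "(\<lambda>p. K * B / \<theta> ^ p) \<longlonglongrightarrow> 0"
    using tendsto_mult_right_zero[OF LIMSEQ_inverse_realpow_zero[OF \<theta>_gt_1], of "K * B"]
    by (simp add: divide_inverse)
  have "Cauchy (\<lambda>n. u n c)" for c
  proof (rule metric_CauchyI)
    fix e :: real assume e: "0 < e"
    obtain p where p: "K * B / \<theta> ^ p < e / 4"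
      using eventually_happens'[OF _ order_tendstoD(2)[OF small, of "e / 4"]] e by auto
    obtain N where N: "\<And>n. n \<ge> N \<Longrightarrow> \<bar>v p n c - R p * l $ c\<bar> < e / 4"
      using LIMSEQ_D[OF v[of p c], of "e / 4"] e by auto
    have close: "\<bar>u n c - R p * l $ c\<bar> < e / 2" if "n \<ge> N + p" for n
    proof -
      have "\<bar>u n c - v p (n - p) c\<bar> \<le> K * B / \<theta> ^ p" using near[of "n - p" p c] that by simp
      moreover have "\<bar>v p (n - p) c - R p * l $ c\<bar> < e / 4" using that by (intro N) simp
      ultimately show ?thesis using p by linarith
    qed
    show "\<exists>M. \<forall>m\<ge>M. \<forall>n\<ge>M. dist (u m c) (u n c) < e"
    proof (intro exI[of _ "N + p"] allI impI)
      fix m n assume "N + p \<le> m" "N + p \<le> n"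
      then show "dist (u m c) (u n c) < e"
        unfolding dist_real_def using close[of m] close[of n] by linarith
    qed
  qed
  then have "\<exists>U. (\<lambda>n. u n c) \<longlonglongrightarrow> U" for c
    by (simp add: Cauchy_convergent_iff convergent_def)
  then obtain U where U: "\<And>c. (\<lambda>n. u n c) \<longlonglongrightarrow> U c" by metis
  have R: "R \<longlonglongrightarrow> (\<Sum>d\<in>UNIV. r $ d * U d)"
    unfolding R_def by (intro tendsto_intros U)
  have UT: "U c = (\<Sum>d\<in>UNIV. r $ d * U d) * l $ c" for c
  proof -
    have "\<bar>U c - R p * l $ c\<bar> \<le> K * B / \<theta> ^ p" for p
    proof (rule LIMSEQ_le_const2)
      show "(\<lambda>n. \<bar>u (n + p) c - v p n c\<bar>) \<longlonglongrightarrow> \<bar>U c - R p * l $ c\<bar>"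
        by (intro tendsto_rabs tendsto_diff v LIMSEQ_ignore_initial_segment U)
    qed (use near in auto)
    then have "(\<lambda>p. R p * l $ c - U c) \<longlonglongrightarrow> 0"
      by (intro Lim_null_comparison[OF _ small]) (simp add: abs_minus_commute)
    then have "(\<lambda>p. R p * l $ c) \<longlonglongrightarrow> U c" by (simp add: LIM_zero_iff)
    moreover have "(\<lambda>p. R p * l $ c) \<longlonglongrightarrow> (\<Sum>d\<in>UNIV. r $ d * U d) * l $ c"
      by (intro tendsto_intros R)
    ultimately show ?thesis by (rule LIMSEQ_unique)
  qed
  show thesis
  proof (rule that)
    show "(\<lambda>n. F (subst_iter \<zeta> n c) / \<theta> ^ n) \<longlonglongrightarrow> (\<Sum>d\<in>UNIV. r $ d * U d) * l $ c" for c
      using U[of c, unfolded u_def] by (subst UT[symmetric])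
  qed
qed

text \<open>The hypothesis says that \<open>D\<close> has mean \<open>0\<close> along each sequence \<open>\<zeta>\<^sup>n(c)\<close>. Choose \<open>p\<close> so large that the
  blocks \<open>\<zeta>\<^sup>p(c)\<close> have discrepancy small enough for \<open>quasi_additive_sublist_of_blocks\<close>; a word of the language
  is a subword of such blocks, unless it comes from \<open>\<zeta>\<^sup>n(a)\<close> with \<open>n < p\<close> and is short.\<close>

lemma language_discrepancy:
  assumes D: "quasi_additive K D"
    and null: "\<And>c. (\<lambda>n. D (subst_iter \<zeta> n c) / \<theta> ^ n) \<longlonglongrightarrow> 0"
    and \<epsilon>: "0 < \<epsilon>"
  obtains M where "\<And>w a n. sublist w (subst_iter \<zeta> n a) \<Longrightarrow> \<bar>D w\<bar> \<le> \<epsilon> * real (length w) + M"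
proof -
  have \<theta>0: "0 < \<theta> ^ n" for n using \<theta>_gt_1 by simp
  obtain C where C: "0 \<le> C" "\<And>w. \<bar>D w\<bar> \<le> C * real (length w)"
    using quasi_additive_linear_bound[OF D] by blast
  have "\<forall>\<^sub>F n in sequentially. \<forall>c. \<bar>D (subst_iter \<zeta> n c)\<bar> + K \<le> \<epsilon> * real (length (subst_iter \<zeta> n c))"
  proof (rule eventually_all_finite)
    fix c
    \<comment> \<open>After division by \<open>\<theta>\<^sup>n\<close> the length stays away from \<open>0\<close>, the other two terms vanish.\<close>
    let ?q = "\<lambda>n. \<epsilon> * (real (length (subst_iter \<zeta> n c)) / \<theta> ^ n) - (\<bar>D (subst_iter \<zeta> n c) / \<theta> ^ n\<bar> + K * inverse (\<theta> ^ n))"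
    have "?q
        \<longlonglongrightarrow> \<epsilon> * ((r \<bullet> 1) * l $ c) - (\<bar>0\<bar> + K * 0)"
      by (intro tendsto_intros length_limit null LIMSEQ_inverse_realpow_zero \<theta>_gt_1)
    moreover have "0 < \<epsilon> * ((r \<bullet> 1) * l $ c) - (\<bar>0\<bar> + K * 0)" using \<epsilon> limit_pos by simp
    ultimately have "\<forall>\<^sub>F n in sequentially. 0 < ?q n"
      by (rule order_tendstoD)
    then show "\<forall>\<^sub>F n in sequentially. \<bar>D (subst_iter \<zeta> n c)\<bar> + K \<le> \<epsilon> * real (length (subst_iter \<zeta> n c))"
    proof (rule eventually_mono)
      fix n
      have "\<bar>D (subst_iter \<zeta> n c) / \<theta> ^ n\<bar> = \<bar>D (subst_iter \<zeta> n c)\<bar> / \<theta> ^ n"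
        using \<theta>0[of n] by (simp add: abs_divide)
      then have eq: "?q n
        = (\<epsilon> * real (length (subst_iter \<zeta> n c)) - (\<bar>D (subst_iter \<zeta> n c)\<bar> + K)) / \<theta> ^ n"
        by (simp add: divide_inverse algebra_simps)
      assume "0 < ?q n"
      then show "\<bar>D (subst_iter \<zeta> n c)\<bar> + K \<le> \<epsilon> * real (length (subst_iter \<zeta> n c))"
        unfolding eq using \<theta>_gt_1 by (auto simp: zero_less_divide_iff)
    qed
  qed
  then obtain p where p: "\<And>c. \<bar>D (subst_iter \<zeta> p c)\<bar> + K \<le> \<epsilon> * real (length (subst_iter \<zeta> p c))"
    using eventually_happens' sequentially_bot by blast
  define M where "M = C * real (Max (range (\<lambda>c. length (subst_iter \<zeta> p c))))"
  have short: "\<bar>D u\<bar> \<le> M" if "length u \<le> length (subst_iter \<zeta> p c)" for u c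
  proof -
    have le_Max: "length (subst_iter \<zeta> p c) \<le> Max (range (\<lambda>c. length (subst_iter \<zeta> p c)))" by simp
    have "C * real (length u) \<le> M"
      unfolding M_def using order_trans[OF that le_Max] by (intro mult_left_mono C) linarith
    then show ?thesis using C(2)[of u] by linarith
  qed
  have mono: "length (subst_iter \<zeta> n a) \<le> length (subst_iter \<zeta> (n + k) a)" for n k a
  proof (induction k)
    case (Suc k)
    have "length w \<le> length (subst_word \<zeta> w)" for w
    proof (induction w)
      case (Cons b w)
      have "1 \<le> length (\<zeta> b)" using substitution by (simp add: substitution_def Suc_le_eq)
      then show ?case using Cons by (simp add: subst_word_def)
    qed simp
    from order_trans[OF Suc this] show ?case by (simp add: subst_iter_Suc)
  qed simp
  show thesis
  proof (rule that)
    fix w a n assume w: "sublist w (subst_iter \<zeta> n a)"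
    show "\<bar>D w\<bar> \<le> \<epsilon> * real (length w) + (2 * M + K)"
    proof (cases "n < p")
      case True
      have "length w \<le> length (subst_iter \<zeta> n a)" by (rule sublist_length_le[OF w])
      also have "\<dots> \<le> length (subst_iter \<zeta> p a)" using mono[of n a "p - n"] True by simp
      finally have "\<bar>D w\<bar> \<le> M" by (rule short)
      moreover have "0 \<le> \<epsilon> * real (length w)" using \<epsilon> by simp
      moreover have "0 \<le> K" by (rule quasi_additive_const_nonneg[OF D])
      ultimately show ?thesis by linarith
    next
      case False
      then have "subst_iter \<zeta> n a = concat (map (subst_iter \<zeta> p) (subst_iter \<zeta> (n - p) a))"
        using subst_iter_add[of \<zeta> "n - p" p a] by simp
      then have w': "sublist w (concat (map (subst_iter \<zeta> p) (subst_iter \<zeta> (n - p) a)))"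
        using w by simp
      show ?thesis
        by (rule quasi_additive_sublist_of_blocks[OF D _ p _ w'])
           (use \<epsilon> in simp, erule short[OF sublist_length_le])
    qed
  qed
qed

end

text \<open>If \<open>\<theta> \<le> 1\<close>, the lengths of all \<open>\<zeta>\<^sup>n(j)\<close> stay bounded, so the language has no long words and the
  substitution space is empty.\<close>

lemma expanding_substitution_if_nonempty_space:
  fixes \<zeta> :: "'a::finite \<Rightarrow> 'a list"
  assumes sub: "substitution \<zeta>" and prim: "primitive_subst \<zeta>"
    and pf: "pf_eigenvalue (subst_matrix \<zeta>) \<theta>"
    and r: "subst_matrix \<zeta> *v r = \<theta> *s r" and l: "transpose (subst_matrix \<zeta>) *v l = \<theta> *s l"
    and rl: "r \<bullet> l = 1"
    and X: "subst_space \<zeta> \<noteq> {}"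
  shows "expanding_substitution \<zeta> \<theta> r l"
proof -
  obtain k where k: "1 \<le> k" "\<And>i j. 0 < mat_power (subst_matrix \<zeta>) k $ i $ j"
    using prim by (auto simp: primitive_subst_def)
  have nonneg: "0 \<le> subst_matrix \<zeta> $ i $ j" for i j by (simp add: subst_matrix_def)
  note pfa = primitive_powers_asymptotics[OF nonneg k pf r l rl]
  have lim: "(\<lambda>n. real (count_list (subst_iter \<zeta> n j) i) / \<theta> ^ n) \<longlonglongrightarrow> r $ i * l $ j" for i j
    using pfa(2)[of i j] by (simp add: mat_power_subst_matrix)
  have "1 < \<theta>"
  proof (rule ccontr)
    assume "\<not> 1 < \<theta>"
    then have \<theta>1: "\<theta> ^ n \<le> 1" for n using pfa(1) by (simp add: power_le_one)
    obtain b where b: "\<And>n j. real (length (subst_iter \<zeta> n j)) / \<theta> ^ n \<le> b"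
      by (rule convergent_finite_family_bounded
                 [where f = "\<lambda>n j. real (length (subst_iter \<zeta> n j)) / \<theta> ^ n" and L = "\<lambda>j. (r \<bullet> 1) * l $ j"])
         (use length_limit_from_count_limits[OF lim] in auto)
    have "real (length (subst_iter \<zeta> n j)) \<le> b" for n j
    proof -
      have "real (length (subst_iter \<zeta> n j)) \<le> real (length (subst_iter \<zeta> n j)) / \<theta> ^ n"
        using \<theta>1[of n] pfa(1) by (simp add: pos_le_divide_eq mult_left_le)
      then show ?thesis using b[of n j] by linarith
    qed
    then have le_b: "real N \<le> b" if "N \<le> length (subst_iter \<zeta> n j)" for N n j
      by (rule order_trans[rotated]) (use that in simp)
    obtain x where "x \<in> subst_space \<zeta>" using X by auto
    then have x: "\<exists>a n. sublist (map (\<lambda>j. x (0 + int j)) [0..<N]) (subst_iter \<zeta> n a)" for N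
      unfolding subst_space_def mem_Collect_eq by (rule allE[where x = 0], elim allE)
    obtain N where N: "b < real N" using reals_Archimedean2 by auto
    obtain a n where "sublist (map (\<lambda>j. x (0 + int j)) [0..<N]) (subst_iter \<zeta> n a)"
      using x[of N] by auto
    from le_b[of N n a] sublist_length_le[OF this] N show False by simp
  qed
  then show ?thesis
    using sub lim pfa(3) by unfold_locales
qed

section \<open>Pair correlations and the invariant measure\<close>

definition pair_count :: "'a \<Rightarrow> 'a \<Rightarrow> nat \<Rightarrow> 'a list \<Rightarrow> nat" where
  "pair_count a b k v = card {j. j + k < length v \<and> v ! (j + k) = a \<and> v ! j = b}"

text \<open>The pairs of \<open>u @ v\<close> are those of \<open>u\<close>, those of \<open>v\<close> and those straddling the junction; the latter start
  at one of the last \<open>k\<close> positions of \<open>u\<close>.\<close>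

lemma quasi_additive_pair_count: "quasi_additive (real k) (\<lambda>v. real (pair_count a b k v))"
  unfolding quasi_additive_def
proof (intro conjI allI)
  show "real (pair_count a b k []) = 0" by (simp add: pair_count_def)
  fix u v :: "'a list"
  define E where "E = (\<lambda>v. {j. j + k < length v \<and> v ! (j + k) = a \<and> v ! j = b})"
  have pc: "pair_count a b k w = card (E w)" for w
    by (simp add: pair_count_def E_def)
  define H where "H = {j \<in> E (u @ v). j < length u \<and> length u \<le> j + k}"
  have fin: "finite (E w)" for w :: "'a list"
    by (rule finite_subset[of _ "{..<length w}"]) (auto simp: E_def)
  have finH: "finite H" using fin by (simp add: H_def)
  have eq: "E (u @ v) = (E u \<union> (+) (length u) ` E v) \<union> H"
  proof (intro set_eqI iffI)
    fix j assume j: "j \<in> E (u @ v)"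
    consider "j + k < length u" | "j < length u" "length u \<le> j + k" | "length u \<le> j" by linarith
    then show "j \<in> (E u \<union> (+) (length u) ` E v) \<union> H"
    proof cases
      case 1
      then show ?thesis using j by (auto simp: E_def nth_append)
    next
      case 2
      then show ?thesis using j by (simp add: H_def)
    next
      case 3
      then have "j - length u \<in> E v" using j by (auto simp: E_def nth_append)
      then show ?thesis using 3 by (metis UnI1 UnI2 image_eqI le_add_diff_inverse)
    qed
  qed (auto simp: E_def H_def nth_append add.assoc)
  have "(E u \<union> (+) (length u) ` E v) \<inter> H = {}"
    by (auto simp: E_def H_def)
  then have "card (E (u @ v)) = card (E u \<union> (+) (length u) ` E v) + card H"
    unfolding eq by (intro card_Un_disjoint finite_UnI finite_imageI fin finH)
  also have "E u \<inter> (+) (length u) ` E v = {}"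
    by (auto simp: E_def)
  then have "card (E u \<union> (+) (length u) ` E v) = card (E u) + card ((+) (length u) ` E v)"
    by (intro card_Un_disjoint finite_imageI fin)
  also have "card ((+) (length u) ` E v) = card (E v)"
    by (rule card_image) simp
  finally have "card (E (u @ v)) = card (E u) + card (E v) + card H" .
  moreover have "card H \<le> card {length u - k..<length u}"
    by (rule card_mono) (auto simp: H_def)
  ultimately show "\<bar>real (pair_count a b k (u @ v)) - real (pair_count a b k u) - real (pair_count a b k v)\<bar> \<le> real k"
    by (simp add: pc)
qed

lemma pair_count_window:
  "real (pair_count a b k (map (\<lambda>j. x (int j)) [0..<N]))
     = (\<Sum>j<N - k. of_bool (x (int j + int k) = a \<and> x (int j) = b))"
proof -
  have "{j. j + k < length (map (\<lambda>j. x (int j)) [0..<N]) \<and> map (\<lambda>j. x (int j)) [0..<N] ! (j + k) = a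
        \<and> map (\<lambda>j. x (int j)) [0..<N] ! j = b}
      = {j \<in> {..<N - k}. x (int j + int k) = a \<and> x (int j) = b}"
    by (auto simp: less_diff_conv)
  then show ?thesis by (simp add: pair_count_def sum.If_cases Int_def of_bool_def)
qed

lemma shift_apply: "shift k x j = x (j + k)"
  by (simp add: shift_def)

locale invariant_measure =
  fixes \<zeta> :: "'a::finite \<Rightarrow> 'a list" and \<mu> :: "(int \<Rightarrow> 'a) measure"
  assumes invariant: "invariant_prob \<zeta> \<mu>"
begin

sublocale prob_space \<mu>
  using invariant by (simp add: invariant_prob_def)

lemma sets_eq: "sets \<mu> = sets (restrict_space (PiM UNIV (\<lambda>_. count_space UNIV)) (subst_space \<zeta>))"
  using invariant by (simp add: invariant_prob_def)

lemma space_eq: "space \<mu> = subst_space \<zeta>"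
  using sets_eq_imp_space_eq[OF sets_eq] by (simp add: space_restrict_space space_PiM)

lemma subst_space_nonempty: "subst_space \<zeta> \<noteq> {}"
  using not_empty by (simp add: space_eq)

lemma shift_in_subst_space: "x \<in> subst_space \<zeta> \<Longrightarrow> shift k x \<in> subst_space \<zeta>"
  unfolding subst_space_def shift_def mem_Collect_eq
proof (intro allI)
  fix i len assume "\<forall>i len. \<exists>a n. sublist (map (\<lambda>j. x (i + int j)) [0..<len]) (subst_iter \<zeta> n a)"
  from spec[OF spec[OF this, of "i + k"], of len]
  show "\<exists>a n. sublist (map (\<lambda>j. x (i + int j + k)) [0..<len]) (subst_iter \<zeta> n a)"
    by (simp add: add_ac)
qed

lemma coordinate_measurable [measurable]: "(\<lambda>x. x i) \<in> \<mu> \<rightarrow>\<^sub>M count_space UNIV"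
proof -
  have "(\<lambda>x. x i) \<in> restrict_space (PiM UNIV (\<lambda>_. count_space UNIV)) (subst_space \<zeta>) \<rightarrow>\<^sub>M count_space UNIV"
    by (intro measurable_restrict_space1 measurable_component_singleton) simp
  then show ?thesis by (simp add: measurable_cong_sets[OF sets_eq refl])
qed

lemma shift_measurable: "shift k \<in> \<mu> \<rightarrow>\<^sub>M \<mu>"
proof -
  have "shift k \<in> \<mu> \<rightarrow>\<^sub>M restrict_space (PiM UNIV (\<lambda>_. count_space UNIV)) (subst_space \<zeta>)"
  proof (rule measurable_restrict_space2)
    show "shift k \<in> space \<mu> \<rightarrow> subst_space \<zeta>"
      using shift_in_subst_space by (auto simp: space_eq)
    show "shift k \<in> \<mu> \<rightarrow>\<^sub>M PiM UNIV (\<lambda>_. count_space UNIV)"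
      unfolding shift_def[abs_def] by (rule measurable_PiM_single') auto
  qed
  then show ?thesis by (simp add: measurable_cong_sets[OF refl sets_eq])
qed

definition pair_prob :: "'a \<Rightarrow> 'a \<Rightarrow> int \<Rightarrow> real" where
  "pair_prob a b k = measure \<mu> {x \<in> space \<mu>. x k = a \<and> x 0 = b}"

lemma pair_prob_shift: "measure \<mu> {x \<in> space \<mu>. x (i + k) = a \<and> x i = b} = pair_prob a b k" for i :: int
proof -
  have step: "measure \<mu> {x \<in> space \<mu>. x (i + 1 + k) = a \<and> x (i + 1) = b}
      = measure \<mu> {x \<in> space \<mu>. x (i + k) = a \<and> x i = b}" for i
  proof -
    let ?E = "{x \<in> space \<mu>. x (i + k) = a \<and> x i = b}"
    have E: "?E \<in> sets \<mu>" by measurable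
    have "measure \<mu> ?E = measure (distr \<mu> \<mu> (shift 1)) ?E"
      using invariant by (simp add: invariant_prob_def)
    also have "\<dots> = measure \<mu> (shift 1 -` ?E \<inter> space \<mu>)"
      by (rule measure_distr[OF shift_measurable E])
    also have "shift 1 -` ?E \<inter> space \<mu> = {x \<in> space \<mu>. x (i + 1 + k) = a \<and> x (i + 1) = b}"
      using shift_in_subst_space by (auto simp: space_eq shift_apply add_ac)
    finally show ?thesis by simp
  qed
  show ?thesis
  proof (induction i rule: int_induct[where k=0])
    case base
    show ?case by (simp add: pair_prob_def)
  next
    case (step1 i)
    then show ?case using step[of i] by simp
  next
    case (step2 i)
    then show ?case using step[of "i - 1"] by simp
  qed
qed

text \<open>This reduces negative lags to positive ones, for which \<open>pair_count\<close> is defined.\<close>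

lemma pair_prob_uminus: "pair_prob a b (- k) = pair_prob b a k"
  using pair_prob_shift[of k "- k" a b] by (simp add: pair_prob_def conj_commute)

lemma correlation_eq_pair_prob:
  "(\<integral>x. (indicator (cylinder \<zeta> a) \<circ> shift k) x * cnj (indicator (cylinder \<zeta> b) x) \<partial>\<mu>)
     = complex_of_real (pair_prob a b k)"
proof -
  have "(\<integral>x. (indicator (cylinder \<zeta> a) \<circ> shift k) x * cnj (indicator (cylinder \<zeta> b) x) \<partial>\<mu>)
      = (\<integral>x. complex_of_real (indicator {x \<in> space \<mu>. x k = a \<and> x 0 = b} x) \<partial>\<mu>)"
    by (intro Bochner_Integration.integral_cong)
       (auto simp: indicator_def cylinder_def space_eq shift_in_subst_space shift_apply)
  also have "\<dots> = complex_of_real (pair_prob a b k)"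
    by (simp add: pair_prob_def integral_complex_of_real del: of_real_indicator)
  finally show ?thesis .
qed

end

text \<open>Let \<open>G\<close> be the common limiting frequency of the pair in the words \<open>\<zeta>\<^sup>n(c)\<close>. The pair count in the
  window \<open>x\<^sub>0, \<dots>, x\<^bsub>N-1\<^esub>\<close> has \<open>\<mu>\<close>-expectation \<open>(N - k) q\<close> with \<open>q\<close> the pair probability, because
  \<open>\<mu>\<close> is invariant; the window being a word of the language, the count differs from \<open>G N\<close> by at most
  \<open>\<epsilon> N + M\<close>. For large \<open>N\<close> this forces \<open>q = G\<close>.\<close>

lemma pair_count_limit:
  fixes \<zeta> :: "'a::finite \<Rightarrow> 'a list"
  assumes "expanding_substitution \<zeta> \<theta> r l" and "invariant_measure \<zeta> \<mu>"
  shows "(\<lambda>n. real (pair_count a b k (subst_iter \<zeta> n c)) / \<theta> ^ n)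
    \<longlonglongrightarrow> (r \<bullet> 1) * l $ c * invariant_measure.pair_prob \<mu> a b (int k)"
proof -
  interpret expanding_substitution \<zeta> \<theta> r l by fact
  interpret invariant_measure \<zeta> \<mu> by fact
  define F where "F = (\<lambda>v::'a list. real (pair_count a b k v))"
  have F: "quasi_additive (real k) F" unfolding F_def by (rule quasi_additive_pair_count)
  obtain R where R: "\<And>c. (\<lambda>n. F (subst_iter \<zeta> n c) / \<theta> ^ n) \<longlonglongrightarrow> R * l $ c"
    using quasi_additive_limit[OF F] by blast
  have r1: "r \<bullet> 1 \<noteq> 0" using limit_pos[of undefined] by auto
  define G where "G = R / (r \<bullet> 1)"
  define D where "D = (\<lambda>v. F v - G * real (length v))"
  have D: "quasi_additive (real k) D"
    using F by (simp add: quasi_additive_def D_def algebra_simps)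
  have null: "(\<lambda>n. D (subst_iter \<zeta> n c) / \<theta> ^ n) \<longlonglongrightarrow> 0" for c
  proof -
    have "(\<lambda>n. F (subst_iter \<zeta> n c) / \<theta> ^ n - G * (real (length (subst_iter \<zeta> n c)) / \<theta> ^ n))
        \<longlonglongrightarrow> R * l $ c - G * ((r \<bullet> 1) * l $ c)"
      by (intro tendsto_intros R length_limit)
    then show ?thesis using r1 by (simp add: D_def G_def diff_divide_distrib)
  qed
  define q where "q = pair_prob a b (int k)"
  have window: "\<bar>real (N - k) * q - G * real N\<bar> \<le> \<epsilon> * real N + M"
    if M: "\<And>w a n. sublist w (subst_iter \<zeta> n a) \<Longrightarrow> \<bar>D w\<bar> \<le> \<epsilon> * real (length w) + M" for \<epsilon> M N
  proof -
    let ?E = "\<lambda>j::nat. {x \<in> space \<mu>. x (int j + int k) = a \<and> x (int j) = b}"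
    define W where "W = (\<lambda>x. (\<Sum>j<N - k. indicator (?E j) x) - G * real N)"
    have int: "integrable \<mu> (\<lambda>x. indicator (?E j) x :: real)" for j
      by (intro integrable_real_indicator) (auto simp: emeasure_eq_measure)
    have "(\<integral>x. W x \<partial>\<mu>) = (\<Sum>j<N - k. measure \<mu> (?E j)) - G * real N"
      unfolding W_def using int
      by (simp add: Bochner_Integration.integral_diff Bochner_Integration.integral_sum prob_space)
    then have EW: "(\<integral>x. W x \<partial>\<mu>) = real (N - k) * q - G * real N"
      by (simp add: pair_prob_shift q_def)
    have intW: "integrable \<mu> W" unfolding W_def using int by simp
    have bound: "\<bar>W x\<bar> \<le> \<epsilon> * real N + M" if x: "x \<in> space \<mu>" for x
    proof -
      let ?w = "map (\<lambda>j. x (int j)) [0..<N]"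
      obtain c n where "sublist (map (\<lambda>j. x (0 + int j)) [0..<N]) (subst_iter \<zeta> n c)"
        using x unfolding space_eq subst_space_def by blast
      then have "\<bar>D ?w\<bar> \<le> \<epsilon> * real (length ?w) + M" by (intro M) simp
      moreover have "D ?w = W x"
        unfolding D_def F_def pair_count_window W_def using x
        by (simp add: indicator_def of_bool_def)
      ultimately show ?thesis by simp
    qed
    have "(\<integral>x. W x \<partial>\<mu>) \<le> \<epsilon> * real N + M"
      using bound by (intro integral_le_const[OF intW] AE_I2) (simp add: abs_le_iff)
    moreover have "- (\<epsilon> * real N + M) \<le> W x" if "x \<in> space \<mu>" for x
      using bound[OF that] by linarith
    then have "- (\<epsilon> * real N + M) \<le> (\<integral>x. W x \<partial>\<mu>)"
      by (intro integral_ge_const[OF intW] AE_I2)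
    ultimately show ?thesis by (simp add: EW abs_le_iff)
  qed
  have "q = G"
  proof (rule ccontr)
    assume "q \<noteq> G"
    define \<epsilon> where "\<epsilon> = \<bar>q - G\<bar> / 2"
    have \<epsilon>: "0 < \<epsilon>" using \<open>q \<noteq> G\<close> by (simp add: \<epsilon>_def)
    obtain M where M: "\<And>w a n. sublist w (subst_iter \<zeta> n a) \<Longrightarrow> \<bar>D w\<bar> \<le> \<epsilon> * real (length w) + M"
      using language_discrepancy[OF D null \<epsilon>] by blast
    obtain N0 where N0: "(M + real k * \<bar>q\<bar>) / \<epsilon> < real N0" using reals_Archimedean2 by blast
    \<comment> \<open>Adding \<open>k\<close> ensures \<open>real (N - k) = real N - real k\<close>.\<close>
    define N where "N = N0 + k"
    have "(M + real k * \<bar>q\<bar>) / \<epsilon> < real N" using N0 by (simp add: N_def)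
    then have large: "M + real k * \<bar>q\<bar> < \<epsilon> * real N" using \<epsilon> by (simp add: field_simps)
    have "real (N - k) * q - G * real N = (q - G) * real N - real k * q"
      by (simp add: N_def algebra_simps)
    moreover have "\<bar>real (N - k) * q - G * real N\<bar> \<le> \<epsilon> * real N + M"
      by (rule window) (rule M)
    ultimately have "\<bar>(q - G) * real N - real k * q\<bar> \<le> \<epsilon> * real N + M" by simp
    then have "\<bar>(q - G) * real N\<bar> \<le> \<epsilon> * real N + M + \<bar>real k * q\<bar>" by linarith
    then have "2 * \<epsilon> * real N \<le> \<epsilon> * real N + M + real k * \<bar>q\<bar>"
      by (simp add: abs_mult \<epsilon>_def)
    then show False using large by simp
  qed
  then have lim_eq: "R * l $ c = (r \<bullet> 1) * l $ c * q" using r1 by (simp add: G_def)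
  show ?thesis using R[of c] unfolding lim_eq unfolding F_def q_def .
qed

section \<open>Integration against complex measures\<close>

definition signed_measure :: "'b measure \<Rightarrow> ('b set \<Rightarrow> real) \<Rightarrow> bool" where
  "signed_measure M \<nu> \<longleftrightarrow> \<nu> {} = 0 \<and>
     (\<forall>A :: nat \<Rightarrow> 'b set. range A \<subseteq> sets M \<and> disjoint_family A \<longrightarrow>
        (\<lambda>i. \<nu> (A i)) sums \<nu> (\<Union>i. A i))"

lemma signed_measure_uminus: "signed_measure M \<nu> \<Longrightarrow> signed_measure M (\<lambda>A. - \<nu> A)"
  by (auto simp: signed_measure_def intro!: sums_minus)

lemma signed_measure_Re: "complex_measure M \<nu> \<Longrightarrow> signed_measure M (\<lambda>A. Re (\<nu> A))"
  by (auto simp: signed_measure_def complex_measure_def intro!: sums_Re)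

lemma signed_measure_Im: "complex_measure M \<nu> \<Longrightarrow> signed_measure M (\<lambda>A. Im (\<nu> A))"
  by (auto simp: signed_measure_def complex_measure_def intro!: sums_Im)

lemma signed_measure_Un:
  assumes "signed_measure M \<nu>" "A \<in> sets M" "B \<in> sets M" "A \<inter> B = {}"
  shows "\<nu> (A \<union> B) = \<nu> A + \<nu> B"
proof -
  have "range (binaryset A B) \<subseteq> sets M"
    using assms by (auto simp: range_binaryset_eq)
  moreover have "disjoint_family (binaryset A B)"
    using assms by (auto simp: disjoint_family_on_def binaryset_def)
  ultimately have "(\<lambda>n. \<nu> (binaryset A B n)) sums \<nu> (A \<union> B)"
    using assms(1) unfolding signed_measure_def UN_binaryset_eq[of A B, symmetric] by blast
  moreover have "(\<lambda>n. \<nu> (binaryset A B n)) sums (\<nu> A + \<nu> B)"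
    using assms(1) by (intro binaryset_sums) (simp add: signed_measure_def)
  ultimately show ?thesis by (rule sums_unique2)
qed

text \<open>The set function from which \<open>upper_variation\<close> is built.\<close>

definition pos_var :: "'b measure \<Rightarrow> ('b set \<Rightarrow> real) \<Rightarrow> 'b set \<Rightarrow> ennreal" where
  "pos_var M \<nu> E = (SUP A\<in>{A \<in> sets M. A \<subseteq> E}. ennreal (\<nu> A))"

lemma le_pos_var: "A \<in> sets M \<Longrightarrow> A \<subseteq> E \<Longrightarrow> ennreal (\<nu> A) \<le> pos_var M \<nu> E"
  unfolding pos_var_def by (rule SUP_upper) simp

lemma pos_var_mono: "E \<subseteq> F \<Longrightarrow> pos_var M \<nu> E \<le> pos_var M \<nu> F"
  unfolding pos_var_def by (rule SUP_subset_mono) auto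

lemma pos_var_empty: "\<nu> {} = 0 \<Longrightarrow> pos_var M \<nu> {} = 0"
proof -
  assume "\<nu> {} = 0"
  moreover have "{A \<in> sets M. A \<subseteq> {}} = {{}}" by auto
  ultimately show ?thesis by (simp add: pos_var_def)
qed

lemma pos_var_superadditive:
  assumes \<nu>: "signed_measure M \<nu>" and E: "E \<inter> F = {}"
  shows "pos_var M \<nu> E + pos_var M \<nu> F \<le> pos_var M \<nu> (E \<union> F)"
proof -
  let ?I = "\<lambda>E. {A \<in> sets M. A \<subseteq> E}"
  have ne: "?I E \<noteq> {}" for E :: "'a set" by (auto intro: exI[of _ "{}"])
  have le: "ennreal (\<nu> A) + ennreal (\<nu> B) \<le> pos_var M \<nu> (E \<union> F)" if "A \<in> ?I E" "B \<in> ?I F" for A B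
  proof (cases "0 \<le> \<nu> A \<and> 0 \<le> \<nu> B")
    case True
    have "A \<inter> B = {}" using that E by auto
    then have "ennreal (\<nu> A) + ennreal (\<nu> B) = ennreal (\<nu> (A \<union> B))"
      using True that by (simp add: signed_measure_Un[OF \<nu>])
    also have "\<dots> \<le> pos_var M \<nu> (E \<union> F)" using that by (intro le_pos_var) auto
    finally show ?thesis .
  next
    case False
    have "ennreal (\<nu> A) \<le> pos_var M \<nu> (E \<union> F)" "ennreal (\<nu> B) \<le> pos_var M \<nu> (E \<union> F)"
      using that by (auto intro!: le_pos_var)
    then show ?thesis using False by (auto simp: ennreal_neg not_le)
  qed
  have "pos_var M \<nu> E + pos_var M \<nu> F = (SUP A\<in>?I E. ennreal (\<nu> A) + pos_var M \<nu> F)"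
    unfolding pos_var_def[of M \<nu> E] by (rule ennreal_SUP_add_left[OF ne, symmetric])
  also have "\<dots> \<le> pos_var M \<nu> (E \<union> F)"
  proof (rule SUP_least)
    fix A assume A: "A \<in> ?I E"
    have "ennreal (\<nu> A) + pos_var M \<nu> F = (SUP B\<in>?I F. ennreal (\<nu> A) + ennreal (\<nu> B))"
      unfolding pos_var_def[of M \<nu> F] by (rule ennreal_SUP_add_right[OF ne])
    also have "\<dots> \<le> pos_var M \<nu> (E \<union> F)" by (rule SUP_least) (rule le[OF A])
    finally show "ennreal (\<nu> A) + pos_var M \<nu> F \<le> pos_var M \<nu> (E \<union> F)" .
  qed
  finally show ?thesis .
qed

lemma ennreal_sum_le: "ennreal (\<Sum>i\<in>I. f i) \<le> (\<Sum>i\<in>I. ennreal (f i))"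
proof (cases "finite I")
  case True
  have "ennreal (\<Sum>i\<in>I. f i) \<le> ennreal (\<Sum>i\<in>I. max 0 (f i))"
    by (intro ennreal_leI sum_mono) simp
  also have "\<dots> = (\<Sum>i\<in>I. ennreal (max 0 (f i)))"
    by (rule sum_ennreal[symmetric]) simp
  also have "\<dots> = (\<Sum>i\<in>I. ennreal (f i))" by (intro sum.cong) (auto simp: max_def ennreal_neg)
  finally show ?thesis .
qed simp

text \<open>Superadditivity on disjoint sets gives one inequality. For the other, \<open>\<nu> A\<close> is the sum of the
  \<open>\<nu> (A \<inter> F i)\<close>, each of which is at most the variation of \<open>F i\<close>.\<close>

lemma countably_additive_pos_var:
  assumes \<nu>: "signed_measure M \<nu>"
  shows "countably_additive (sets M) (pos_var M \<nu>)"
proof (rule countably_additiveI)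
  fix F :: "nat \<Rightarrow> 'a set"
  assume F: "range F \<subseteq> sets M" "disjoint_family F"
  show "(\<Sum>i. pos_var M \<nu> (F i)) = pos_var M \<nu> (\<Union>i. F i)"
  proof (rule antisym)
    have "(\<Sum>i<n. pos_var M \<nu> (F i)) \<le> pos_var M \<nu> (\<Union>i<n. F i)" for n
    proof (induction n)
      case 0
      show ?case by simp
    next
      case (Suc n)
      have "F i \<inter> F n = {}" if "i < n" for i
        using F(2) that by (simp add: disjoint_family_on_def)
      then have "(\<Union>i<n. F i) \<inter> F n = {}" by blast
      have "(\<Sum>i<Suc n. pos_var M \<nu> (F i)) \<le> pos_var M \<nu> (\<Union>i<n. F i) + pos_var M \<nu> (F n)"
        using Suc by (simp add: add_right_mono)
      also have "\<dots> \<le> pos_var M \<nu> ((\<Union>i<n. F i) \<union> F n)"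
        by (rule pos_var_superadditive[OF \<nu> \<open>(\<Union>i<n. F i) \<inter> F n = {}\<close>])
      also have "(\<Union>i<n. F i) \<union> F n = (\<Union>i<Suc n. F i)" by (auto simp: lessThan_Suc)
      finally show ?case .
    qed
    also have "pos_var M \<nu> (\<Union>i<n. F i) \<le> pos_var M \<nu> (\<Union>i. F i)" for n by (rule pos_var_mono) auto
    finally show "(\<Sum>i. pos_var M \<nu> (F i)) \<le> pos_var M \<nu> (\<Union>i. F i)"
      by (intro suminf_le_const) auto
  next
    show "pos_var M \<nu> (\<Union>i. F i) \<le> (\<Sum>i. pos_var M \<nu> (F i))"
      unfolding pos_var_def[of M \<nu> "\<Union>i. F i"]
    proof (rule SUP_least)
      fix A assume A: "A \<in> {A \<in> sets M. A \<subseteq> (\<Union>i. F i)}"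
      have "range (\<lambda>i. A \<inter> F i) \<subseteq> sets M" using A F by auto
      moreover have "disjoint_family (\<lambda>i. A \<inter> F i)" using F by (auto simp: disjoint_family_on_def)
      moreover have "(\<Union>i. A \<inter> F i) = A" using A by auto
      ultimately have "(\<lambda>i. \<nu> (A \<inter> F i)) sums \<nu> A"
        using \<nu> unfolding signed_measure_def by metis
      then have "(\<lambda>n. ennreal (\<Sum>i<n. \<nu> (A \<inter> F i))) \<longlonglongrightarrow> ennreal (\<nu> A)"
        unfolding sums_def by (rule tendsto_ennrealI)
      moreover have "ennreal (\<Sum>i<n. \<nu> (A \<inter> F i)) \<le> (\<Sum>i. pos_var M \<nu> (F i))" for n
      proof -
        have "ennreal (\<Sum>i<n. \<nu> (A \<inter> F i)) \<le> (\<Sum>i<n. ennreal (\<nu> (A \<inter> F i)))" by (rule ennreal_sum_le)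
        also have "\<dots> \<le> (\<Sum>i<n. pos_var M \<nu> (F i))"
          using A F by (intro sum_mono le_pos_var) auto
        also have "\<dots> \<le> (\<Sum>i. pos_var M \<nu> (F i))" by (intro sum_le_suminf) auto
        finally show ?thesis .
      qed
      ultimately show "ennreal (\<nu> A) \<le> (\<Sum>i. pos_var M \<nu> (F i))"
        by (intro LIMSEQ_le_const2) auto
    qed
  qed
qed

lemma sets_upper_variation [simp, measurable_cong]: "sets (upper_variation M \<nu>) = sets M"
  by (simp add: upper_variation_def)

lemma space_upper_variation [simp]: "space (upper_variation M \<nu>) = space M"
  by (simp add: upper_variation_def)

lemma upper_variation_pos_var: "upper_variation M \<nu> = measure_of (space M) (sets M) (pos_var M \<nu>)"
  by (simp add: upper_variation_def pos_var_def[abs_def])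

lemma emeasure_upper_variation:
  assumes \<nu>: "signed_measure M \<nu>" and E: "E \<in> sets M"
  shows "emeasure (upper_variation M \<nu>) E = pos_var M \<nu> E"
proof (rule emeasure_measure_of[OF upper_variation_pos_var sets.space_closed])
  show "positive (sets (upper_variation M \<nu>)) (pos_var M \<nu>)"
    using \<nu> by (simp add: positive_def pos_var_empty signed_measure_def)
  show "countably_additive (sets (upper_variation M \<nu>)) (pos_var M \<nu>)"
    using countably_additive_pos_var[OF \<nu>] by simp
qed (use E in simp)

text \<open>If a set \<open>E\<close> has infinite variation, choose \<open>A \<subseteq> E\<close> with \<open>\<nu> A > \<bar>\<nu> E\<bar> + 1\<close>. Then
  \<open>A\<close> and \<open>E - A\<close> both have \<open>\<bar>\<nu>\<bar> \<ge> 1\<close>, and one of them has infinite variation. Continuing with that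
  one and splitting off the other yields disjoint sets \<open>D n\<close> with \<open>\<bar>\<nu> (D n)\<bar> \<ge> 1\<close>, while
  \<open>\<nu> (D n)\<close> is a summable series.\<close>

lemma finite_measure_upper_variation:
  assumes \<nu>: "signed_measure M \<nu>"
  shows "finite_measure (upper_variation M \<nu>)"
proof
  show "emeasure (upper_variation M \<nu>) (space (upper_variation M \<nu>)) \<noteq> \<infinity>"
  proof
    assume inf: "emeasure (upper_variation M \<nu>) (space (upper_variation M \<nu>)) = \<infinity>"
    define P where "P = (\<lambda>E. E \<in> sets M \<and> pos_var M \<nu> E = \<infinity>)"
    have step: "\<exists>B. P B \<and> (B \<subseteq> E \<and> 1 \<le> \<bar>\<nu> (E - B)\<bar>)" if "P E" for E
    proof -
      have E: "E \<in> sets M" "pos_var M \<nu> E = \<infinity>" using that by (auto simp: P_def)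
      have "ennreal (\<bar>\<nu> E\<bar> + 1) < pos_var M \<nu> E" by (simp add: E)
      then obtain A where A: "A \<in> sets M" "A \<subseteq> E" "ennreal (\<bar>\<nu> E\<bar> + 1) < ennreal (\<nu> A)"
        unfolding pos_var_def less_SUP_iff by auto
      have big: "\<bar>\<nu> E\<bar> + 1 < \<nu> A" using A(3) by (subst (asm) ennreal_less_iff) auto
      have "\<nu> (A \<union> (E - A)) = \<nu> A + \<nu> (E - A)"
        using A E by (intro signed_measure_Un[OF \<nu>]) auto
      moreover have un: "A \<union> (E - A) = E" using A by auto
      ultimately have diff: "1 \<le> \<bar>\<nu> (E - A)\<bar>" using big by simp
      have "pos_var M \<nu> A + pos_var M \<nu> (E - A) = \<infinity>"
        using plus_emeasure[of A "upper_variation M \<nu>" "E - A"] A E un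
        by (simp add: emeasure_upper_variation[OF \<nu>] Diff_disjoint)
      then consider "pos_var M \<nu> A = \<infinity>" | "pos_var M \<nu> (E - A) = \<infinity>"
        by (auto simp: ennreal_add_eq_top)
      then show ?thesis
      proof cases
        case 1
        then show ?thesis using A diff by (auto simp: P_def)
      next
        case 2
        have "E - (E - A) = A" using A by auto
        then show ?thesis using 2 A E big by (intro exI[of _ "E - A"]) (auto simp: P_def)
      qed
    qed
    have "P (space M)"
      using inf by (simp add: P_def emeasure_upper_variation[OF \<nu>])
    then have "\<exists>G. \<forall>n. P (G n) \<and> (G (Suc n) \<subseteq> G n \<and> 1 \<le> \<bar>\<nu> (G n - G (Suc n))\<bar>)"
      by (intro dependent_nat_choice) (auto dest: step)
    then obtain G where G: "\<And>n. P (G n)" "\<And>n. G (Suc n) \<subseteq> G n" "\<And>n. 1 \<le> \<bar>\<nu> (G n - G (Suc n))\<bar>"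
      by auto
    define D where "D = (\<lambda>n. G n - G (Suc n))"
    have "decseq G" using G(2) by (simp add: decseq_Suc_iff)
    have "D m \<inter> D n = {}" if "m < n" for m n
      using decseqD[OF \<open>decseq G\<close>, of "Suc m" n] that by (auto simp: D_def)
    then have "disjoint_family D"
      unfolding disjoint_family_on_def by (metis Int_commute linorder_neqE_nat)
    moreover have "range D \<subseteq> sets M" using G(1) by (auto simp: D_def P_def)
    ultimately have "summable (\<lambda>n. \<nu> (D n))"
      using \<nu> unfolding signed_measure_def by (metis sums_summable)
    then have "(\<lambda>n. \<nu> (D n)) \<longlonglongrightarrow> 0" by (rule summable_LIMSEQ_zero)
    then have "(\<lambda>n. \<bar>\<nu> (D n)\<bar>) \<longlonglongrightarrow> 0" by (simp add: tendsto_rabs_zero)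
    then have "1 \<le> (0::real)"
      by (rule LIMSEQ_le_const) (use G(3) in \<open>auto simp: D_def\<close>)
    then show False by simp
  qed
qed

lemma upper_variation_scale:
  assumes \<nu>: "signed_measure M \<nu>" and c: "0 < c"
  shows "upper_variation M (\<lambda>A. c * \<nu> A) = density (upper_variation M \<nu>) (\<lambda>_. ennreal c)"
proof (rule measure_eqI)
  have c\<nu>: "signed_measure M (\<lambda>A. c * \<nu> A)"
    using \<nu> by (auto simp: signed_measure_def intro!: sums_mult)
  fix E assume "E \<in> sets (upper_variation M (\<lambda>A. c * \<nu> A))"
  then show "emeasure (upper_variation M (\<lambda>A. c * \<nu> A)) E = emeasure (density (upper_variation M \<nu>) (\<lambda>_. ennreal c)) E"
    using c by (simp add: emeasure_upper_variation[OF c\<nu>] emeasure_upper_variation[OF \<nu>] pos_var_def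
        emeasure_density_const ennreal_mult' SUP_mult_left_ennreal)
qed simp

lemma integrable_upper_variation:
  fixes f :: "'b \<Rightarrow> complex"
  assumes "signed_measure M \<nu>" "f \<in> borel_measurable M" "\<And>x. x \<in> space M \<Longrightarrow> norm (f x) \<le> B"
  shows "integrable (upper_variation M \<nu>) f"
proof -
  interpret finite_measure "upper_variation M \<nu>" by (rule finite_measure_upper_variation) fact
  show ?thesis
    using assms by (intro integrable_const_bound[of _ B]) auto
qed

definition bounded_measurable :: "'b measure \<Rightarrow> ('b \<Rightarrow> complex) \<Rightarrow> bool" where
  "bounded_measurable M f \<longleftrightarrow> f \<in> borel_measurable M \<and> (\<exists>B. \<forall>x\<in>space M. norm (f x) \<le> B)"

lemma cm_integral_add:
  assumes "complex_measure M \<nu>" "bounded_measurable M f" "bounded_measurable M g"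
  shows "cm_integral M \<nu> (\<lambda>x. f x + g x) = cm_integral M \<nu> f + cm_integral M \<nu> g"
proof -
  have "integrable (upper_variation M \<tau>) f \<and> integrable (upper_variation M \<tau>) g" if "signed_measure M \<tau>" for \<tau>
    using assms integrable_upper_variation[OF that] unfolding bounded_measurable_def by blast
  then have "signed_integral M \<tau> (\<lambda>x. f x + g x) = signed_integral M \<tau> f + signed_integral M \<tau> g"
    if "signed_measure M \<tau>" for \<tau>
    using that signed_measure_uminus[OF that] by (simp add: signed_integral_def)
  from this[OF signed_measure_Re[OF assms(1)]] this[OF signed_measure_Im[OF assms(1)]]
  show ?thesis by (simp add: cm_integral_def algebra_simps)
qed

lemma cm_integral_mult:
  "cm_integral M \<nu> (\<lambda>x. c * f x) = c * cm_integral M \<nu> f"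
  by (simp add: cm_integral_def signed_integral_def algebra_simps)

text \<open>The constant \<open>C\<close>, the total mass of the four variations, is independent of \<open>f\<close>: integration
  against \<open>\<nu>\<close> is continuous for the supremum norm.\<close>

lemma cm_integral_bound:
  assumes "complex_measure M \<nu>"
  obtains C where "0 \<le> C"
    "\<And>f B. f \<in> borel_measurable M \<Longrightarrow> (\<And>x. x \<in> space M \<Longrightarrow> norm (f x) \<le> B) \<Longrightarrow> 0 \<le> B \<Longrightarrow> norm (cm_integral M \<nu> f) \<le> C * B"
proof -
  define m where "m = (\<lambda>\<tau>. measure (upper_variation M \<tau>) (space M))"
  have one: "norm (integral\<^sup>L (upper_variation M \<tau>) f) \<le> m \<tau> * B"
    if "signed_measure M \<tau>" "f \<in> borel_measurable M" "\<And>x. x \<in> space M \<Longrightarrow> norm (f x) \<le> B" "0 \<le> B" for \<tau> B and f :: "'a \<Rightarrow> complex"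
  proof -
    interpret finite_measure "upper_variation M \<tau>" by (rule finite_measure_upper_variation) fact
    have "norm (integral\<^sup>L (upper_variation M \<tau>) f) \<le> (\<integral>x. norm (f x) \<partial>upper_variation M \<tau>)"
      by (rule integral_norm_bound)
    also have "\<dots> \<le> (\<integral>x. B \<partial>upper_variation M \<tau>)"
      using integrable_upper_variation[OF that(1-3)] that(3) by (intro integral_mono) auto
    finally show ?thesis by (simp add: m_def)
  qed
  have two: "norm (signed_integral M \<tau> f) \<le> (m \<tau> + m (\<lambda>A. - \<tau> A)) * B"
    if "signed_measure M \<tau>" "f \<in> borel_measurable M" "\<And>x. x \<in> space M \<Longrightarrow> norm (f x) \<le> B" "0 \<le> B" for \<tau> B and f :: "'a \<Rightarrow> complex"
    using norm_triangle_ineq4[of "integral\<^sup>L (upper_variation M \<tau>) f" "integral\<^sup>L (upper_variation M (\<lambda>A. - \<tau> A)) f"]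
      one[OF that] one[OF signed_measure_uminus[OF that(1)] that(2-4)]
    by (simp add: signed_integral_def algebra_simps)
  define C where "C = (m (\<lambda>A. Re (\<nu> A)) + m (\<lambda>A. - Re (\<nu> A))) + (m (\<lambda>A. Im (\<nu> A)) + m (\<lambda>A. - Im (\<nu> A)))"
  show thesis
  proof (rule that)
    show "0 \<le> C" by (simp add: C_def m_def)
    fix f :: "'a \<Rightarrow> complex" and B
    assume f: "f \<in> borel_measurable M" "\<And>x. x \<in> space M \<Longrightarrow> norm (f x) \<le> B" "0 \<le> B"
    show "norm (cm_integral M \<nu> f) \<le> C * B"
      using norm_triangle_ineq[of "signed_integral M (\<lambda>A. Re (\<nu> A)) f" "\<i> * signed_integral M (\<lambda>A. Im (\<nu> A)) f"]
        two[OF signed_measure_Re[OF assms] f] two[OF signed_measure_Im[OF assms] f]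
      by (simp add: cm_integral_def C_def norm_mult algebra_simps)
  qed
qed

lemma complex_measure_scale:
  "complex_measure M \<nu> \<Longrightarrow> complex_measure M (\<lambda>A. c * \<nu> A)"
  by (auto simp: complex_measure_def intro!: sums_mult)

lemma cm_integral_scale:
  assumes \<nu>: "complex_measure M \<nu>" and c: "0 < c"
    and f: "f \<in> borel_measurable M"
  shows "cm_integral M (\<lambda>A. complex_of_real c * \<nu> A) f = complex_of_real c * cm_integral M \<nu> f"
proof -
  have "signed_integral M (\<lambda>A. c * \<tau> A) f = complex_of_real c * signed_integral M \<tau> f" if "signed_measure M \<tau>" for \<tau>
  proof -
    have "integral\<^sup>L (upper_variation M (\<lambda>A. c * \<tau> A)) f = complex_of_real c * integral\<^sup>L (upper_variation M \<tau>) f"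
      if "signed_measure M \<tau>" for \<tau>
      using c f unfolding upper_variation_scale[OF that c]
      by (subst integral_density) (auto simp: scaleR_conv_of_real)
    from this[OF that] this[OF signed_measure_uminus[OF that]]
    show ?thesis by (simp add: signed_integral_def algebra_simps)
  qed
  from this[OF signed_measure_Re[OF \<nu>]] this[OF signed_measure_Im[OF \<nu>]]
  show ?thesis by (simp add: cm_integral_def algebra_simps)
qed

text \<open>The supremum of \<open>\<nu> A\<close> over \<open>A \<subseteq> E\<close> is attained at the part of \<open>E\<close> where \<open>g \<ge> 0\<close>.\<close>

lemma upper_variation_density:
  fixes g :: "'b \<Rightarrow> real"
  assumes g: "integrable M g"
    and \<nu>: "\<And>A. A \<in> sets M \<Longrightarrow> \<nu> A = (LINT x:A|M. g x)"
  shows "upper_variation M \<nu> = density M (\<lambda>x. ennreal (max 0 (g x)))"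
proof -
  let ?D = "density M (\<lambda>x. ennreal (max 0 (g x)))"
  have [measurable]: "g \<in> borel_measurable M" using g by simp
  have "integrable M (\<lambda>x. max 0 (g x))" using g by (intro integrable_max) auto
  then have si: "set_integrable M A g" "set_integrable M A (\<lambda>x. max 0 (g x))" if "A \<in> sets M" for A
    unfolding set_integrable_def using g that by (auto intro!: integrable_mult_indicator simp del: real_scaleR_def)
  have nn: "emeasure ?D A = ennreal (LINT x:A|M. max 0 (g x))" if [measurable]: "A \<in> sets M" for A
  proof -
    have "emeasure ?D A = (\<integral>\<^sup>+x. ennreal (max 0 (g x)) * indicator A x \<partial>M)"
      by (simp add: emeasure_density)
    also have "\<dots> = (\<integral>\<^sup>+x. ennreal (indicator A x * max 0 (g x)) \<partial>M)"
      by (intro nn_integral_cong) (auto simp: indicator_def)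
    also have "\<dots> = ennreal (\<integral>x. indicator A x * max 0 (g x) \<partial>M)"
      using si(2)[OF that] by (intro nn_integral_eq_integral) (auto simp: set_integrable_def)
    finally show ?thesis by (simp add: set_lebesgue_integral_def)
  qed
  have "pos_var M \<nu> E = emeasure ?D E" if E: "E \<in> sets M" for E
  proof (rule antisym)
    show "pos_var M \<nu> E \<le> emeasure ?D E"
      unfolding pos_var_def
    proof (rule SUP_least)
      fix A assume A: "A \<in> {A \<in> sets M. A \<subseteq> E}"
      have "(LINT x:A|M. g x) \<le> (LINT x:A|M. max 0 (g x))"
        using A by (intro set_integral_mono si) auto
      then have "ennreal (\<nu> A) \<le> emeasure ?D A"
        using A \<nu>[of A] by (subst nn) (auto intro: ennreal_leI)
      also have "\<dots> \<le> emeasure ?D E" using A E by (intro emeasure_mono) auto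
      finally show "ennreal (\<nu> A) \<le> emeasure ?D E" .
    qed
    define A where "A = {x \<in> E. 0 \<le> g x}"
    have A_eq: "A = E \<inter> {x \<in> space M. 0 \<le> g x}" using sets.sets_into_space[OF E] by (auto simp: A_def)
    have A: "A \<in> sets M" unfolding A_eq using E by measurable
    have "(LINT x:E|M. max 0 (g x)) = (LINT x:A|M. g x)"
      unfolding set_lebesgue_integral_def
      by (intro Bochner_Integration.integral_cong) (auto simp: A_def indicator_def)
    then have "emeasure ?D E = ennreal (\<nu> A)" unfolding nn[OF E] \<nu>[OF A] by simp
    also have "\<dots> \<le> pos_var M \<nu> E" using A by (intro le_pos_var) (auto simp: A_def)
    finally show "emeasure ?D E \<le> pos_var M \<nu> E" .
  qed
  then have "upper_variation M \<nu> = measure_of (space M) (sets M) (emeasure ?D)"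
    unfolding upper_variation_pos_var
    by (intro measure_of_eq sets.space_closed) (simp add: sets.sigma_sets_eq)
  also have "\<dots> = ?D" using measure_of_of_measure[of ?D] by simp
  finally show ?thesis .
qed

lemma cm_integral_density:
  assumes h: "integrable M h" and f: "bounded_measurable M f"
  shows "cm_integral M (cm_density M h) f = (\<integral>x. f x * h x \<partial>M)"
proof -
  obtain B where B: "\<And>x. x \<in> space M \<Longrightarrow> norm (f x) \<le> B" and [measurable]: "f \<in> borel_measurable M"
    using f by (auto simp: bounded_measurable_def)
  have int: "integrable M (\<lambda>x. g x *\<^sub>R f x)" if "integrable M g" for g :: "'a \<Rightarrow> real"
  proof (rule Bochner_Integration.integrable_bound)
    show "integrable M (\<lambda>x. B * g x)" using that by simp
    show "AE x in M. norm (g x *\<^sub>R f x) \<le> norm (B * g x)"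
    proof (rule AE_I2)
      fix x assume "x \<in> space M"
      then have "norm (f x) \<le> \<bar>B\<bar>" using B[of x] by linarith
      then show "norm (g x *\<^sub>R f x) \<le> norm (B * g x)"
        by (simp add: abs_mult mult.commute[of "\<bar>B\<bar>"] mult_left_mono)
    qed
  qed (use that in measurable)
  have signed: "signed_integral M \<tau> f = (\<integral>x. g x *\<^sub>R f x \<partial>M)"
    if g: "integrable M g" and \<tau>: "\<And>A. A \<in> sets M \<Longrightarrow> \<tau> A = (LINT x:A|M. g x)" for \<tau> g
  proof -
    have pos: "upper_variation M \<tau> = density M (\<lambda>x. ennreal (max 0 (g x)))"
      by (rule upper_variation_density[OF g \<tau>])
    have "- \<tau> A = (LINT x:A|M. - g x)" if "A \<in> sets M" for A
      using \<tau>[OF that] g by (simp add: set_lebesgue_integral_def)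
    then have neg: "upper_variation M (\<lambda>A. - \<tau> A) = density M (\<lambda>x. ennreal (max 0 (- g x)))"
      using g by (intro upper_variation_density) auto
    have [measurable]: "g \<in> borel_measurable M" using g by simp
    have "signed_integral M \<tau> f = (\<integral>x. max 0 (g x) *\<^sub>R f x \<partial>M) - (\<integral>x. max 0 (- g x) *\<^sub>R f x \<partial>M)"
      unfolding signed_integral_def pos neg by (subst (1 2) integral_density) auto
    also have "\<dots> = (\<integral>x. max 0 (g x) *\<^sub>R f x - max 0 (- g x) *\<^sub>R f x \<partial>M)"
      by (rule Bochner_Integration.integral_diff[symmetric]) (intro int integrable_max; use g in simp)+
    also have "\<dots> = (\<integral>x. g x *\<^sub>R f x \<partial>M)"
      by (intro Bochner_Integration.integral_cong) (auto simp: max_def)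
    finally show ?thesis .
  qed
  have set_h: "set_integrable M A h" if "A \<in> sets M" for A
    using h that unfolding set_integrable_def by (intro integrable_mult_indicator)
  have "signed_integral M (\<lambda>A. Re (cm_density M h A)) f = (\<integral>x. Re (h x) *\<^sub>R f x \<partial>M)"
  proof (rule signed)
    show "Re (cm_density M h A) = (LINT x:A|M. Re (h x))" if "A \<in> sets M" for A
      using that integral_Re[OF set_h[OF that, unfolded set_integrable_def]]
      by (simp add: cm_density_def set_lebesgue_integral_def)
  qed (use h in simp)
  moreover have "signed_integral M (\<lambda>A. Im (cm_density M h A)) f = (\<integral>x. Im (h x) *\<^sub>R f x \<partial>M)"
  proof (rule signed)
    show "Im (cm_density M h A) = (LINT x:A|M. Im (h x))" if "A \<in> sets M" for A
      using that integral_Im[OF set_h[OF that, unfolded set_integrable_def]]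
      by (simp add: cm_density_def set_lebesgue_integral_def)
  qed (use h in simp)
  moreover have Re_int: "integrable M (\<lambda>x. Re (h x) *\<^sub>R f x)" and Im_int: "integrable M (\<lambda>x. Im (h x) *\<^sub>R f x)"
    using h by (auto intro: int)
  ultimately have "cm_integral M (cm_density M h) f = (\<integral>x. Re (h x) *\<^sub>R f x + \<i> * (Im (h x) *\<^sub>R f x) \<partial>M)"
    unfolding cm_integral_def
    by (simp only: Bochner_Integration.integral_add[OF Re_int integrable_mult_right[OF Im_int]] integral_mult_right_zero)
  also have "\<dots> = (\<integral>x. f x * h x \<partial>M)"
  proof (rule Bochner_Integration.integral_cong)
    fix x
    have "Re (h x) *\<^sub>R f x + \<i> * (Im (h x) *\<^sub>R f x) = f x * (complex_of_real (Re (h x)) + \<i> * complex_of_real (Im (h x)))"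
      by (simp add: scaleR_conv_of_real algebra_simps)
    then show "Re (h x) *\<^sub>R f x + \<i> * (Im (h x) *\<^sub>R f x) = f x * h x" by (simp flip: complex_eq)
  qed simp
  finally show ?thesis .
qed

section \<open>Weak-star convergence on the circle from Fourier coefficients\<close>

definition character :: "int \<Rightarrow> real \<Rightarrow> complex" where
  "character k \<omega> = exp (2 * of_real pi * \<i> * of_int k * of_real \<omega>)"

lemma character_0 [simp]: "character 0 \<omega> = 1"
  by (simp add: character_def)

lemma character_add: "character (j + k) \<omega> = character j \<omega> * character k \<omega>"
  by (simp add: character_def algebra_simps exp_add)

lemma cnj_character: "cnj (character k \<omega>) = character (- k) \<omega>"
  by (simp add: character_def exp_cnj)

lemma continuous_on_character: "continuous_on A (character k)"
  unfolding character_def by (intro continuous_intros)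

lemma space_circle [simp]: "space circle = {0..<1}"
  by (simp add: circle_def space_restrict_space)

lemma borel_measurable_circle: "f \<in> borel_measurable borel \<Longrightarrow> f \<in> borel_measurable circle"
  by (simp add: circle_def measurable_restrict_space1)

lemma finite_measure_circle: "finite_measure circle"
proof
  show "emeasure circle (space circle) \<noteq> \<infinity>"
    by (simp add: circle_def emeasure_restrict_space space_restrict_space)
qed

lemma measure_circle: "measure circle (space circle) = 1"
  by (simp add: circle_def measure_restrict_space space_restrict_space)

lemma integrable_circle:
  fixes f :: "real \<Rightarrow> complex"
  assumes "continuous_on UNIV f" shows "integrable circle f"
proof -
  interpret finite_measure circle by (rule finite_measure_circle)
  have "compact (f ` {0..1})"
    by (intro compact_continuous_image continuous_on_subset[OF assms]) auto
  then obtain B where "\<And>x. x \<in> {0..1} \<Longrightarrow> norm (f x) \<le> B"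
    by (meson bounded_iff compact_imp_bounded image_eqI)
  then show ?thesis
    by (intro integrable_const_bound[of _ B] borel_measurable_circle borel_measurable_continuous_onI assms AE_I2) auto
qed

lemma bounded_measurable_continuous:
  assumes "continuous_on UNIV f" shows "bounded_measurable circle f"
proof -
  have "compact (f ` {0..1})"
    by (intro compact_continuous_image continuous_on_subset[OF assms]) auto
  then obtain B where "\<And>x. x \<in> {0..1} \<Longrightarrow> norm (f x) \<le> B"
    by (meson bounded_iff compact_imp_bounded image_eqI)
  then have "\<forall>x\<in>space circle. norm (f x) \<le> B" by auto
  then show ?thesis
    unfolding bounded_measurable_def
    by (auto intro: borel_measurable_circle borel_measurable_continuous_onI assms)
qed

lemma integral_character: "(\<integral>\<omega>. character k \<omega> \<partial>circle) = (if k = 0 then 1 else 0)"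
proof (cases "k = 0")
  case True
  then show ?thesis using measure_circle by simp
next
  case False
  define c where "c = 2 * of_real pi * \<i> * complex_of_int k"
  have c: "c \<noteq> 0" using False by (simp add: c_def)
  have ch: "character k = (\<lambda>\<omega>. exp (c * of_real \<omega>))" by (simp add: character_def c_def fun_eq_iff)
  have "(\<integral>\<omega>. character k \<omega> \<partial>circle) = (LBINT \<omega>:{0..<1}. character k \<omega>)"
    by (simp add: circle_def integral_restrict_space set_lebesgue_integral_def)
  also have "\<dots> = (LBINT \<omega>=ereal 0..ereal 1. character k \<omega>)"
    by (rule interval_integral_Ico[symmetric]) simp
  also have "\<dots> = exp (c * of_real 1) / c - exp (c * of_real 0) / c"
  proof (rule interval_integral_FTC_finite)
    show "continuous_on {min 0 1..max 0 1} (character k)" by (rule continuous_on_character)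
    fix x :: real
    have "((\<lambda>z. exp (c * z) / c) has_field_derivative exp (c * of_real x)) (at (of_real x))"
      using c by (auto intro!: derivative_eq_intros)
    from has_vector_derivative_real_field[OF this]
    show "((\<lambda>\<omega>. exp (c * of_real \<omega>) / c) has_vector_derivative character k x) (at x within {min 0 1..max 0 1})"
      by (simp add: ch o_def)
  qed
  also have "exp (c * of_real 1) = 1"
    using exp_integer_2pi[of "of_int k"] by (simp add: c_def mult_ac)
  finally show ?thesis using False by simp
qed

inductive trig_polynomial :: "(real \<Rightarrow> complex) \<Rightarrow> bool" where
  char: "trig_polynomial (\<lambda>\<omega>. c * character k \<omega>)"
| add: "trig_polynomial f \<Longrightarrow> trig_polynomial g \<Longrightarrow> trig_polynomial (\<lambda>\<omega>. f \<omega> + g \<omega>)"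

lemma continuous_on_trig_polynomial: "trig_polynomial f \<Longrightarrow> continuous_on UNIV f"
  by (induction rule: trig_polynomial.induct) (auto intro!: continuous_intros continuous_on_character)

lemma trig_polynomial_const: "trig_polynomial (\<lambda>\<omega>. c)"
  using trig_polynomial.char[of c 0] by simp

lemma trig_polynomial_mult_char: "trig_polynomial f \<Longrightarrow> trig_polynomial (\<lambda>\<omega>. c * character k \<omega> * f \<omega>)"
proof (induction rule: trig_polynomial.induct)
  case (char d j)
  have "(\<lambda>\<omega>. c * character k \<omega> * (d * character j \<omega>)) = (\<lambda>\<omega>. (c * d) * character (k + j) \<omega>)"
    by (simp add: character_add mult_ac)
  then show ?case by (simp add: trig_polynomial.char del: mult.assoc)
next
  case (add f g)
  from trig_polynomial.add[OF add.IH] show ?case by (simp add: distrib_left)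
qed

lemma trig_polynomial_mult:
  assumes "trig_polynomial f" "trig_polynomial g"
  shows "trig_polynomial (\<lambda>\<omega>. f \<omega> * g \<omega>)"
  using assms
proof (induction rule: trig_polynomial.induct)
  case (char c k)
  then show ?case by (rule trig_polynomial_mult_char)
next
  case (add f1 f2)
  from trig_polynomial.add[OF add.IH(1)[OF add.prems] add.IH(2)[OF add.prems]]
  show ?case by (simp add: distrib_right)
qed

text \<open>On the unit circle the coordinates are \<open>(z + 1/z) / 2\<close> and \<open>(z - 1/z) / (2 \<i>)\<close>, and trigonometric
  polynomials form an algebra.\<close>

lemma trig_polynomial_real_polynomial:
  fixes p :: "complex \<Rightarrow> real"
  assumes "real_polynomial_function p"
  shows "trig_polynomial (\<lambda>\<omega>. complex_of_real (p (cis (2 * pi * \<omega>))))"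
  using assms
proof (induction rule: real_polynomial_function.induct)
  case (linear f)
  have lin: "f z = Re z * f 1 + Im z * f \<i>" for z
  proof -
    have "f z = f (Re z *\<^sub>R 1 + Im z *\<^sub>R \<i>)"
      by (rule arg_cong[of _ _ f]) (simp add: complex_eq_iff)
    also have "\<dots> = Re z * f 1 + Im z * f \<i>"
      using bounded_linear.linear[OF linear] by (simp add: linear_add linear_scale)
    finally show ?thesis .
  qed
  have "complex_of_real (f (cis (2 * pi * \<omega>)))
     = (f 1 / 2 - \<i> * f \<i> / 2) * character 1 \<omega> + (f 1 / 2 + \<i> * f \<i> / 2) * character (- 1) \<omega>" for \<omega>
  proof -
    have c: "character 1 \<omega> = cis (2 * pi * \<omega>)"
      by (simp add: character_def cis_conv_exp mult_ac)
    then have c': "character (- 1) \<omega> = cnj (cis (2 * pi * \<omega>))"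
      using cnj_character[of 1 \<omega>] by simp
    show ?thesis
      unfolding lin[of "cis (2 * pi * \<omega>)"] c c' by (simp add: complex_eq_iff field_simps)
  qed
  then show ?case
    using trig_polynomial.add[OF trig_polynomial.char[of "f 1 / 2 - \<i> * f \<i> / 2" 1]
        trig_polynomial.char[of "f 1 / 2 + \<i> * f \<i> / 2" "- 1"]] by simp
next
  case (const c)
  show ?case by (rule trig_polynomial_const)
next
  case (add f g)
  then show ?case by (simp add: trig_polynomial.add)
next
  case (mult f g)
  then show ?case by (simp add: trig_polynomial_mult)
qed

text \<open>A continuous function of period \<open>1\<close> is a closed path, hence factors through a continuous function
  \<open>g\<close> on the unit circle, to which Stone--Weierstrass applies.\<close>

lemma trig_polynomial_dense:
  assumes f: "continuous_on UNIV f" and per: "\<And>\<omega>. f (\<omega> + 1) = f \<omega>" and \<epsilon>: "0 < \<epsilon>"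
  obtains T where "trig_polynomial T" "\<And>\<omega>. \<omega> \<in> space circle \<Longrightarrow> norm (f \<omega> - T \<omega>) \<le> \<epsilon>"
proof -
  define g where "g = f \<circ> (\<lambda>z. Arg2pi z / (2 * pi))"
  \<comment> \<open>The continuity of \<open>g\<close> at \<open>1\<close>, where the argument jumps, comes from the
      correspondence between loops and circle maps, applied to the constant homotopy.\<close>
  have "homotopic_loops UNIV f f"
    unfolding homotopic_loops_refl
    using per[of 0] continuous_on_subset[OF f, of "{0..1}"]
    by (simp add: path_def pathstart_def pathfinish_def)
  then have "homotopic_with_canon (\<lambda>h. True) (sphere 0 1) UNIV g g"
    unfolding g_def by (rule homotopic_loops_imp_homotopic_circlemaps)
  then have g: "continuous_on (sphere 0 1) g"
    by (simp add: homotopic_with_imp_continuous)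
  have real_approx: "\<exists>T. trig_polynomial T \<and> (\<forall>\<omega>. norm (complex_of_real (h (cis (2 * pi * \<omega>))) - T \<omega>) \<le> \<epsilon> / 2)"
    if h: "continuous_on (sphere 0 1) h" for h :: "complex \<Rightarrow> real"
  proof -
    obtain p where p: "real_polynomial_function p" "\<And>z. z \<in> sphere 0 1 \<Longrightarrow> \<bar>h z - p z\<bar> < \<epsilon> / 2"
      using Stone_Weierstrass_real_polynomial_function[OF compact_sphere h, of "\<epsilon> / 2"] \<epsilon> by auto
    have "norm (complex_of_real (h (cis (2 * pi * \<omega>))) - complex_of_real (p (cis (2 * pi * \<omega>)))) \<le> \<epsilon> / 2" for \<omega>
      using p(2)[of "cis (2 * pi * \<omega>)"] by (simp flip: of_real_diff)
    then show ?thesis using trig_polynomial_real_polynomial[OF p(1)] by blast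
  qed
  obtain T1 where T1: "trig_polynomial T1" "\<And>\<omega>. norm (complex_of_real (Re (g (cis (2 * pi * \<omega>)))) - T1 \<omega>) \<le> \<epsilon> / 2"
    using real_approx[of "\<lambda>z. Re (g z)"] g by (auto intro: continuous_intros)
  obtain T2 where T2: "trig_polynomial T2" "\<And>\<omega>. norm (complex_of_real (Im (g (cis (2 * pi * \<omega>)))) - T2 \<omega>) \<le> \<epsilon> / 2"
    using real_approx[of "\<lambda>z. Im (g z)"] g by (auto intro: continuous_intros)
  show thesis
  proof (rule that)
    show "trig_polynomial (\<lambda>\<omega>. T1 \<omega> + \<i> * T2 \<omega>)"
      by (intro trig_polynomial.add T1 trig_polynomial_mult trig_polynomial_const T2)
    fix \<omega> assume "\<omega> \<in> space circle"
    then have "Arg2pi (cis (2 * pi * \<omega>)) = 2 * pi * \<omega>"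
      by (intro Arg2pi_unique[of 1]) (auto simp: cis_conv_exp)
    then have fg: "f \<omega> = complex_of_real (Re (g (cis (2 * pi * \<omega>)))) + \<i> * complex_of_real (Im (g (cis (2 * pi * \<omega>))))"
      by (simp add: g_def flip: complex_eq)
    have "norm (f \<omega> - (T1 \<omega> + \<i> * T2 \<omega>))
       \<le> norm (complex_of_real (Re (g (cis (2 * pi * \<omega>)))) - T1 \<omega>) + norm (\<i> * (complex_of_real (Im (g (cis (2 * pi * \<omega>)))) - T2 \<omega>))"
      unfolding fg by (rule order_trans[OF _ norm_triangle_ineq]) (simp add: algebra_simps)
    then show "norm (f \<omega> - (T1 \<omega> + \<i> * T2 \<omega>)) \<le> \<epsilon>"
      using T1(2)[of \<omega>] T2(2)[of \<omega>] by (simp add: norm_mult)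
  qed
qed

text \<open>The moments give convergence on trigonometric polynomials. The functionals for the densities \<open>h n\<close>
  have norm at most \<open>C\<close> and the one for \<open>L\<close> is bounded, so convergence passes to uniform limits.\<close>

theorem weak_star_limit_by_moments:
  fixes h :: "nat \<Rightarrow> real \<Rightarrow> complex"
  assumes h: "\<And>n. continuous_on UNIV (h n)"
    and L1: "\<And>n. (\<integral>\<omega>. norm (h n \<omega>) \<partial>circle) \<le> C"
    and L: "complex_measure circle L"
    and moments: "\<And>k. (\<lambda>n. \<integral>\<omega>. character k \<omega> * h n \<omega> \<partial>circle) \<longlonglongrightarrow> cm_integral circle L (character k)"
  shows "weak_star_limit (\<lambda>n. cm_density circle (h n)) L"
proof -
  define \<Lambda> where "\<Lambda> = (\<lambda>n. cm_integral circle (cm_density circle (h n)))"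
  have \<Lambda>: "\<Lambda> n f = (\<integral>\<omega>. f \<omega> * h n \<omega> \<partial>circle)" if "continuous_on UNIV f" for n f
    unfolding \<Lambda>_def by (intro cm_integral_density integrable_circle h bounded_measurable_continuous that)
  obtain B where B: "0 \<le> B" "\<And>f b. f \<in> borel_measurable circle \<Longrightarrow> (\<And>x. x \<in> space circle \<Longrightarrow> norm (f x) \<le> b) \<Longrightarrow> 0 \<le> b \<Longrightarrow> norm (cm_integral circle L f) \<le> B * b"
    using cm_integral_bound[OF L] by blast
  have C0: "0 \<le> C" using order_trans[OF _ L1[of 0]] by simp
  have trig: "(\<lambda>n. \<Lambda> n T) \<longlonglongrightarrow> cm_integral circle L T" if "trig_polynomial T" for T
    using that
  proof (induction rule: trig_polynomial.induct)
    case (char c k)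
    have "\<Lambda> n (\<lambda>\<omega>. c * character k \<omega>) = c * (\<integral>\<omega>. character k \<omega> * h n \<omega> \<partial>circle)" for n
      by (subst \<Lambda>) (auto intro!: continuous_intros continuous_on_character simp: mult.assoc)
    then show ?case unfolding cm_integral_mult by (simp add: tendsto_mult_left moments)
  next
    case (add f g)
    note cont = continuous_on_trig_polynomial[OF add.hyps(1)] continuous_on_trig_polynomial[OF add.hyps(2)]
    have "\<Lambda> n (\<lambda>\<omega>. f \<omega> + g \<omega>) = \<Lambda> n f + \<Lambda> n g" for n
      using cont h[of n]
      by (simp add: \<Lambda> continuous_on_add distrib_right Bochner_Integration.integral_add integrable_circle continuous_on_mult)
    then show ?case
      unfolding cm_integral_add[OF L cont[THEN bounded_measurable_continuous]]
      by (simp add: tendsto_add add.IH)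
  qed
  have "(\<lambda>n. \<Lambda> n f) \<longlonglongrightarrow> cm_integral circle L f"
    if f: "continuous_on UNIV f" and per: "\<And>\<omega>. f (\<omega> + 1) = f \<omega>" for f
  proof (rule LIMSEQ_I)
    fix e :: real assume e: "0 < e"
    define s where "s = B + C + 1"
    define \<epsilon> where "\<epsilon> = e / (2 * s)"
    have pos: "0 < s" using B(1) C0 by (simp add: s_def)
    have \<epsilon>: "0 < \<epsilon>" using e pos by (simp add: \<epsilon>_def)
    obtain T where T: "trig_polynomial T" "\<And>\<omega>. \<omega> \<in> space circle \<Longrightarrow> norm (f \<omega> - T \<omega>) \<le> \<epsilon>"
      using trig_polynomial_dense[OF f per \<epsilon>] by blast
    note contT = continuous_on_trig_polynomial[OF T(1)]
    have diff: "continuous_on UNIV (\<lambda>\<omega>. f \<omega> - T \<omega>)" by (intro continuous_intros f contT)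
    have n_part: "norm (\<Lambda> n f - \<Lambda> n T) \<le> \<epsilon> * C" for n
    proof -
      have "\<Lambda> n f - \<Lambda> n T = (\<integral>\<omega>. (f \<omega> - T \<omega>) * h n \<omega> \<partial>circle)"
        by (simp add: \<Lambda> f contT left_diff_distrib Bochner_Integration.integral_diff integrable_circle continuous_on_mult h)
      also have "norm \<dots> \<le> (\<integral>\<omega>. norm ((f \<omega> - T \<omega>) * h n \<omega>) \<partial>circle)" by (rule integral_norm_bound)
      also have "\<dots> \<le> (\<integral>\<omega>. \<epsilon> * norm (h n \<omega>) \<partial>circle)"
        by (intro integral_mono integrable_norm integrable_mult_right integrable_circle continuous_intros diff h)
           (auto simp: norm_mult intro!: mult_right_mono T(2))
      also have "\<dots> \<le> \<epsilon> * C" using L1[of n] \<epsilon> by simp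
      finally show ?thesis .
    qed
    have "cm_integral circle L (\<lambda>\<omega>. (f \<omega> - T \<omega>) + T \<omega>) = cm_integral circle L (\<lambda>\<omega>. f \<omega> - T \<omega>) + cm_integral circle L T"
      by (intro cm_integral_add L bounded_measurable_continuous diff contT)
    then have "cm_integral circle L f - cm_integral circle L T = cm_integral circle L (\<lambda>\<omega>. f \<omega> - T \<omega>)" by simp
    moreover have "norm (cm_integral circle L (\<lambda>\<omega>. f \<omega> - T \<omega>)) \<le> B * \<epsilon>"
      using \<epsilon> by (intro B T borel_measurable_circle borel_measurable_continuous_onI diff) auto
    ultimately have L_part: "norm (cm_integral circle L f - cm_integral circle L T) \<le> B * \<epsilon>" by simp
    obtain N where N: "\<And>n. n \<ge> N \<Longrightarrow> norm (\<Lambda> n T - cm_integral circle L T) < \<epsilon>"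
      using LIMSEQ_D[OF trig[OF T(1)] \<epsilon>] by auto
    show "\<exists>N. \<forall>n\<ge>N. norm (\<Lambda> n f - cm_integral circle L f) < e"
    proof (intro exI allI impI)
      fix n assume "N \<le> n"
      have "\<Lambda> n f - cm_integral circle L f = (\<Lambda> n f - \<Lambda> n T) + (\<Lambda> n T - cm_integral circle L T) - (cm_integral circle L f - cm_integral circle L T)"
        by simp
      also have "norm \<dots> \<le> norm (\<Lambda> n f - \<Lambda> n T) + norm (\<Lambda> n T - cm_integral circle L T) + norm (cm_integral circle L f - cm_integral circle L T)"
        by (intro order_trans[OF norm_triangle_ineq4] add_right_mono norm_triangle_ineq)
      also have "\<dots> < \<epsilon> * C + \<epsilon> + B * \<epsilon>"
        using n_part[of n] N[OF \<open>N \<le> n\<close>] L_part by linarith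
      also have "\<dots> = e / 2"
      proof -
        have "\<epsilon> * C + \<epsilon> + B * \<epsilon> = \<epsilon> * s" by (simp add: s_def algebra_simps)
        also have "\<dots> = e / 2" using pos by (simp add: \<epsilon>_def)
        finally show ?thesis .
      qed
      also have "\<dots> < e" using e by simp
      finally show "norm (\<Lambda> n f - cm_integral circle L f) < e" .
    qed
  qed
  then show ?thesis unfolding weak_star_limit_def \<Lambda>_def using L by simp
qed

section \<open>The matrix Riesz product\<close>

lemma Phi_eq_sum_character: "Phi a v \<omega> = (\<Sum>j | j < length v \<and> v ! j = a. character (- int j) \<omega>)"
  unfolding Phi_def character_def by (intro sum.cong) (simp_all add: mult_ac)

lemma continuous_on_Phi: "continuous_on A (Phi a v)"
  unfolding Phi_eq_sum_character[abs_def] by (intro continuous_intros continuous_on_character)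

text \<open>Expanding the product of exponential sums leaves one character for each pair of positions \<open>i\<close>, \<open>j\<close>
  carrying the letters \<open>a\<close> and \<open>b\<close>; orthogonality keeps the pairs with \<open>i = j + k\<close>.\<close>

lemma Phi_correlation_moment:
  "(\<integral>\<omega>. character k \<omega> * (Phi a v \<omega> * cnj (Phi b v \<omega>)) \<partial>circle)
     = of_nat (if 0 \<le> k then pair_count a b (nat k) v else pair_count b a (nat (- k)) v)"
proof -
  define J where "J = (\<lambda>a. {j. j < length v \<and> v ! j = a})"
  have fin: "finite (J a)" for a by (simp add: J_def)
  have "character k \<omega> * (Phi a v \<omega> * cnj (Phi b v \<omega>))
      = (\<Sum>i\<in>J a. \<Sum>j\<in>J b. character (k + (- int i + int j)) \<omega>)" for \<omega>
  proof -
    have "character k \<omega> * (Phi a v \<omega> * cnj (Phi b v \<omega>))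
        = character k \<omega> * ((\<Sum>i\<in>J a. character (- int i) \<omega>) * (\<Sum>j\<in>J b. character (int j) \<omega>))"
      by (simp add: Phi_eq_sum_character J_def cnj_character)
    also have "\<dots> = (\<Sum>i\<in>J a. \<Sum>j\<in>J b. character (k + (- int i + int j)) \<omega>)"
      by (subst sum_product) (simp only: sum_distrib_left character_add)
    finally show ?thesis .
  qed
  then have "(\<integral>\<omega>. character k \<omega> * (Phi a v \<omega> * cnj (Phi b v \<omega>)) \<partial>circle)
      = (\<Sum>i\<in>J a. \<Sum>j\<in>J b. \<integral>\<omega>. character (k + (- int i + int j)) \<omega> \<partial>circle)"
    by (simp add: Bochner_Integration.integral_sum integrable_circle continuous_on_character)
  also have "\<dots> = (\<Sum>i\<in>J a. \<Sum>j\<in>J b. of_nat (of_bool (int i = int j + k)))"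
    by (intro sum.cong) (auto simp: integral_character)
  finally have eq: "(\<integral>\<omega>. character k \<omega> * (Phi a v \<omega> * cnj (Phi b v \<omega>)) \<partial>circle)
      = of_nat (\<Sum>i\<in>J a. \<Sum>j\<in>J b. of_bool (int i = int j + k))" by simp
  have count: "(\<Sum>j\<in>J b. \<Sum>i\<in>J a. of_bool (i = j + n)) = pair_count a b n v" for a b n
  proof -
    have "(\<Sum>j\<in>J b. \<Sum>i\<in>J a. of_bool (i = j + n)) = (\<Sum>j\<in>J b. of_bool (j + n \<in> J a) :: nat)"
      using fin by (intro sum.cong) (auto simp: of_bool_def sum.delta')
    also have "\<dots> = card {j \<in> J b. j + n \<in> J a}"
      using fin by (simp add: of_bool_def Int_def flip: sum.inter_filter)
    also have "{j \<in> J b. j + n \<in> J a} = {j. j + n < length v \<and> v ! (j + n) = a \<and> v ! j = b}"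
      by (auto simp: J_def)
    finally show ?thesis by (simp add: pair_count_def)
  qed
  show ?thesis
  proof (cases "0 \<le> k")
    case True
    have "(int i = int j + k) = (i = j + nat k)" for i j using True by linarith
    then show ?thesis unfolding eq using True count[where b = b and a = a and n = "nat k"]
      by (subst sum.swap) simp
  next
    case False
    have "(int i = int j + k) = (j = i + nat (- k))" for i j using False by linarith
    then show ?thesis unfolding eq using False count[where b = a and a = b and n = "nat (- k)"] by simp
  qed
qed

text \<open>The moment of order \<open>0\<close> of \<open>Phi a v \<cdot> cnj (Phi a v)\<close> counts the occurrences of \<open>a\<close>.\<close>

lemma Phi_L2_norm_bound: "(\<integral>\<omega>. (norm (Phi a v \<omega>))\<^sup>2 \<partial>circle) \<le> real (length v)"
proof -
  have "complex_of_real (\<integral>\<omega>. (norm (Phi a v \<omega>))\<^sup>2 \<partial>circle)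
      = (\<integral>\<omega>. complex_of_real ((norm (Phi a v \<omega>))\<^sup>2) \<partial>circle)"
    by (rule integral_complex_of_real[symmetric])
  also have "\<dots> = complex_of_real (real (pair_count a a 0 v))"
    using Phi_correlation_moment[of 0 a v a] by (simp add: complex_norm_square del: of_real_power)
  finally have "(\<integral>\<omega>. (norm (Phi a v \<omega>))\<^sup>2 \<partial>circle) = real (pair_count a a 0 v)"
    by (simp only: of_real_eq_iff)
  moreover have "pair_count a a 0 v \<le> card {..<length v}"
    unfolding pair_count_def by (rule card_mono) auto
  ultimately show ?thesis by simp
qed

lemma Riesz_matrix_correlation:
  "((1 / \<theta> ^ n) *\<^sub>R map_matrix cnj (conj_transpose (Riesz_matrix \<zeta> n \<omega>) ** Riesz_matrix \<zeta> n \<omega>)) $ a $ b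
     = complex_of_real (1 / \<theta> ^ n) * (\<Sum>c\<in>UNIV. Phi a (subst_iter \<zeta> n c) \<omega> * cnj (Phi b (subst_iter \<zeta> n c) \<omega>))"
  unfolding vector_scaleR_component scaleR_conv_of_real[where 'a = complex]
  by (simp add: map_matrix_def conj_transpose_def transpose_def matrix_matrix_mult_def Riesz_matrix_def)

theorem lemma3p3:
  fixes \<zeta> :: "'a::finite \<Rightarrow> 'a list"
    and \<theta> :: real
    and r l :: "real^'a"
    and \<mu> :: "(int \<Rightarrow> 'a) measure"
    and \<Sigma> :: "'a \<Rightarrow> 'a \<Rightarrow> real set \<Rightarrow> complex"
  assumes "substitution \<zeta>"
    and "primitive_subst \<zeta>"
    and "aperiodic_subst \<zeta>"
    and "pf_eigenvalue (subst_matrix \<zeta>) \<theta>"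
    and "subst_matrix \<zeta> *v r = \<theta> *s r"
    and "transpose (subst_matrix \<zeta>) *v l = \<theta> *s l"
    and "r \<bullet> l = 1"
    and "invariant_prob \<zeta> \<mu>"
    and "correlation_matrix \<zeta> \<mu> \<Sigma>"
  shows "\<exists>L :: 'a \<Rightarrow> 'a \<Rightarrow> real set \<Rightarrow> complex.
      (\<forall>a b. weak_star_limit
         (\<lambda>n. cm_density circle
            (\<lambda>\<omega>. ((1 / \<theta> ^ n) *\<^sub>R
               map_matrix cnj (conj_transpose (Riesz_matrix \<zeta> n \<omega>) ** Riesz_matrix \<zeta> n \<omega>)) $ a $ b))
         (L a b)) \<and>
      (\<forall>a b. \<Sigma> a b = (\<lambda>A. complex_of_real (1 / ((r \<bullet> 1) * (1 \<bullet> l))) * L a b A))"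
proof -
  interpret invariant_measure \<zeta> \<mu>
    by unfold_locales (rule assms(8))
  have "expanding_substitution \<zeta> \<theta> r l"
    by (rule expanding_substitution_if_nonempty_space) (use assms subst_space_nonempty in auto)
  then interpret expanding_substitution \<zeta> \<theta> r l .
  have \<theta>0: "0 < \<theta> ^ n" for n using \<theta>_gt_1 by simp
  define C where "C = (r \<bullet> 1) * (1 \<bullet> l)"
  have C_sum: "C = (\<Sum>c\<in>UNIV. (r \<bullet> 1) * l $ c)"
    by (simp add: C_def inner_vec_def sum_distrib_left)
  have C: "0 < C" unfolding C_sum by (rule sum_pos) (use limit_pos in auto)
  define w where "w = (\<lambda>n c. subst_iter \<zeta> n c)"
  define h where "h = (\<lambda>a b n \<omega>. complex_of_real (1 / \<theta> ^ n) * (\<Sum>c\<in>UNIV. Phi a (w n c) \<omega> * cnj (Phi b (w n c) \<omega>)))"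
  have cont: "continuous_on UNIV (h a b n)" for a b n
    unfolding h_def by (intro continuous_intros continuous_on_Phi)
  obtain B where B: "0 < B" "\<And>n j. real (length (w n j)) \<le> B * \<theta> ^ n"
    unfolding w_def using length_bounded by blast
  \<comment> \<open>The \<open>L\<^sup>1\<close> norm is at most \<open>\<theta>\<^bsup>-n\<^esup>\<close> times the total length of the words \<open>\<zeta>\<^sup>n(c)\<close>, which is bounded in \<open>n\<close>.\<close>
  have L1: "(\<integral>\<omega>. norm (h a b n \<omega>) \<partial>circle) \<le> real CARD('a) * B" for a b n
  proof -
    have sq: "integrable circle (\<lambda>\<omega>. (norm (Phi d v \<omega>))\<^sup>2)" for d :: 'a and v
    proof -
      have "integrable circle (\<lambda>\<omega>. norm (Phi d v \<omega> * Phi d v \<omega>))"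
        by (intro integrable_norm integrable_circle continuous_intros continuous_on_Phi)
      then show ?thesis by (simp add: norm_mult power2_eq_square)
    qed
    have "(\<integral>\<omega>. norm (h a b n \<omega>) \<partial>circle)
        \<le> (\<integral>\<omega>. 1 / \<theta> ^ n * (\<Sum>c\<in>UNIV. ((norm (Phi a (w n c) \<omega>))\<^sup>2 + (norm (Phi b (w n c) \<omega>))\<^sup>2) / 2) \<partial>circle)"
    proof (rule integral_mono)
      show "integrable circle (\<lambda>\<omega>. norm (h a b n \<omega>))" by (intro integrable_norm integrable_circle cont)
      show "integrable circle (\<lambda>\<omega>. 1 / \<theta> ^ n * (\<Sum>c\<in>UNIV. ((norm (Phi a (w n c) \<omega>))\<^sup>2 + (norm (Phi b (w n c) \<omega>))\<^sup>2) / 2))"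
        by (intro integrable_mult_right Bochner_Integration.integrable_sum integrable_divide_zero Bochner_Integration.integrable_add sq)
      fix \<omega>
      have "norm (\<Sum>c\<in>UNIV. Phi a (w n c) \<omega> * cnj (Phi b (w n c) \<omega>))
          \<le> (\<Sum>c\<in>UNIV. ((norm (Phi a (w n c) \<omega>))\<^sup>2 + (norm (Phi b (w n c) \<omega>))\<^sup>2) / 2)"
      proof (rule order_trans[OF norm_sum sum_mono])
        fix c
        show "norm (Phi a (w n c) \<omega> * cnj (Phi b (w n c) \<omega>)) \<le> ((norm (Phi a (w n c) \<omega>))\<^sup>2 + (norm (Phi b (w n c) \<omega>))\<^sup>2) / 2"
          using sum_squares_bound[of "norm (Phi a (w n c) \<omega>)" "norm (Phi b (w n c) \<omega>)"]
          by (simp add: norm_mult)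
      qed
      then show "norm (h a b n \<omega>) \<le> 1 / \<theta> ^ n * (\<Sum>c\<in>UNIV. ((norm (Phi a (w n c) \<omega>))\<^sup>2 + (norm (Phi b (w n c) \<omega>))\<^sup>2) / 2)"
        unfolding h_def norm_mult norm_of_real using \<theta>0[of n] by (intro mult_mono) auto
    qed
    also have "\<dots> = 1 / \<theta> ^ n * (\<Sum>c\<in>UNIV. ((\<integral>\<omega>. (norm (Phi a (w n c) \<omega>))\<^sup>2 \<partial>circle) + (\<integral>\<omega>. (norm (Phi b (w n c) \<omega>))\<^sup>2 \<partial>circle)) / 2)"
      by (simp add: Bochner_Integration.integral_sum Bochner_Integration.integral_add sq)
    also have "\<dots> \<le> 1 / \<theta> ^ n * (\<Sum>c\<in>(UNIV::'a set). B * \<theta> ^ n)"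
    proof (intro mult_left_mono sum_mono)
      fix c
      have "(\<integral>\<omega>. (norm (Phi a (w n c) \<omega>))\<^sup>2 \<partial>circle) + (\<integral>\<omega>. (norm (Phi b (w n c) \<omega>))\<^sup>2 \<partial>circle)
          \<le> B * \<theta> ^ n + B * \<theta> ^ n"
        by (intro add_mono order_trans[OF Phi_L2_norm_bound] B)
      then show "((\<integral>\<omega>. (norm (Phi a (w n c) \<omega>))\<^sup>2 \<partial>circle) + (\<integral>\<omega>. (norm (Phi b (w n c) \<omega>))\<^sup>2 \<partial>circle)) / 2 \<le> B * \<theta> ^ n"
        by simp
    qed (use \<theta>0[of n] in simp)
    also have "\<dots> = real CARD('a) * B" using \<theta>_gt_1 by simp
    finally show ?thesis .
  qed
  have moments: "(\<lambda>n. \<integral>\<omega>. character k \<omega> * h a b n \<omega> \<partial>circle) \<longlonglongrightarrow> complex_of_real (C * pair_prob a b k)" for a b k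
  proof -
    define N where "N = (\<lambda>v. if 0 \<le> k then pair_count a b (nat k) v else pair_count b a (nat (- k)) v)"
    have "(\<integral>\<omega>. character k \<omega> * h a b n \<omega> \<partial>circle) = complex_of_real (\<Sum>c\<in>UNIV. real (N (w n c)) / \<theta> ^ n)" for n
    proof -
      have "(\<integral>\<omega>. character k \<omega> * h a b n \<omega> \<partial>circle)
          = (\<integral>\<omega>. complex_of_real (1 / \<theta> ^ n) * (\<Sum>c\<in>UNIV. character k \<omega> * (Phi a (w n c) \<omega> * cnj (Phi b (w n c) \<omega>))) \<partial>circle)"
        by (intro Bochner_Integration.integral_cong) (simp_all add: h_def sum_distrib_left mult_ac)
      also have "\<dots> = complex_of_real (1 / \<theta> ^ n) * (\<Sum>c\<in>UNIV. \<integral>\<omega>. character k \<omega> * (Phi a (w n c) \<omega> * cnj (Phi b (w n c) \<omega>)) \<partial>circle)"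
        by (subst integral_mult_right_zero, subst Bochner_Integration.integral_sum)
           (auto intro!: integrable_circle continuous_intros continuous_on_character continuous_on_Phi)
      finally show ?thesis
        by (simp add: Phi_correlation_moment N_def sum_divide_distrib)
    qed
    moreover have "(\<lambda>n. real (N (w n c)) / \<theta> ^ n) \<longlonglongrightarrow> (r \<bullet> 1) * l $ c * pair_prob a b k" for c
    proof (cases "0 \<le> k")
      case True
      then show ?thesis
        using pair_count_limit[OF expanding_substitution_axioms invariant_measure_axioms, of a b "nat k" c]
        by (simp add: N_def w_def)
    next
      case False
      then show ?thesis
        using pair_count_limit[OF expanding_substitution_axioms invariant_measure_axioms, of b a "nat (- k)" c]
        by (simp add: N_def w_def pair_prob_uminus)
    qed
    then have "(\<lambda>n. complex_of_real (\<Sum>c\<in>UNIV. real (N (w n c)) / \<theta> ^ n))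
        \<longlonglongrightarrow> complex_of_real (\<Sum>c\<in>UNIV. (r \<bullet> 1) * l $ c * pair_prob a b k)"
      by (intro tendsto_of_real tendsto_sum)
    ultimately show ?thesis by (simp add: C_sum sum_distrib_right)
  qed
  have spectral: "complex_measure circle (\<Sigma> a b)" "cm_integral circle (\<Sigma> a b) (character k) = complex_of_real (pair_prob a b k)" for a b k
    using assms(9) correlation_eq_pair_prob[of a k b]
    unfolding correlation_matrix_def spectral_measure_def character_def[abs_def] by auto
  \<comment> \<open>As \<open>C > 0\<close>, the limit is a positive multiple of \<open>\<Sigma>\<close>, and the prefactor in the statement
      cancels it.\<close>
  define L where "L = (\<lambda>a b A. complex_of_real C * \<Sigma> a b A)"
  have "weak_star_limit (\<lambda>n. cm_density circle (h a b n)) (L a b)" for a b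
  proof (rule weak_star_limit_by_moments[OF cont L1])
    show "complex_measure circle (L a b)"
      unfolding L_def by (intro complex_measure_scale spectral)
    have "cm_integral circle (L a b) (character k) = complex_of_real C * cm_integral circle (\<Sigma> a b) (character k)" for k
      unfolding L_def
      by (intro cm_integral_scale spectral C borel_measurable_circle borel_measurable_continuous_onI continuous_on_character)
    then show "(\<lambda>n. \<integral>\<omega>. character k \<omega> * h a b n \<omega> \<partial>circle) \<longlonglongrightarrow> cm_integral circle (L a b) (character k)" for k
      using moments[of k a b] by (simp add: spectral)
  qed
  moreover have "h a b n = (\<lambda>\<omega>. ((1 / \<theta> ^ n) *\<^sub>R map_matrix cnj (conj_transpose (Riesz_matrix \<zeta> n \<omega>) ** Riesz_matrix \<zeta> n \<omega>)) $ a $ b)" for a b n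
    unfolding h_def w_def Riesz_matrix_correlation ..
  moreover have "\<Sigma> a b = (\<lambda>A. complex_of_real (1 / ((r \<bullet> 1) * (1 \<bullet> l))) * L a b A)" for a b
    using C unfolding C_def[symmetric] by (simp add: L_def)
  ultimately show ?thesis by (intro exI[of _ L]) simp
qed

end
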